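(* Let $C$ be a fixed constant. (1) Let $\lambda$ be a partition of $n$ with $C$ parts and let $N$ be an integer no larger than $n$. Then the function $$(1^N\,0\,1^{\lambda_1}\,0\,1^{\lambda_2}\,0\,\dots\,0\,1^{\lambda_C})\mapsto\#\mathrm{SSYT}_N(\lambda)$$ is in $\#\mathsf{L}$. (2) Similarly, let $\lambda$ be a partition of $n$ with $\lambda_1\le C$ and let $N$ be an integer no larger than $n$. Then the function $$(1^N\,0\,1^{\lambda_1}\,0\,1^{\lambda_2}\,0\,\dots)\mapsto\#\mathrm{SSYT}_N(\lambda)$$ is in $\#\mathsf{L}$.
   Context: The Young diagram of $\lambda$ is $[\lambda]=\{(i,j)\mid 1\le j\le\lambda_i\}$. $\mathrm{SSYT}_N(\lambda)$ is the set of semistandard Young tableaux of shape $\lambda$ with entries in $[N]=\{1,\dots,N\}$: maps $T:[\lambda]\to[N]$ with $T(i,j)\le T(i,j+1)$ and $T(i,j)<T(i+1,j)$ whenever defined. The alphabet is $\Sigma=\{0,1\}$; $1^a$ is the string of $a$ ones and juxtaposition is concatenation. A function given only on strings of a specified form is extended by $0$ to all other strings. $\#\mathsf{L}$ is the class of functions $f:\Sigma^*\to\mathbb{N}_0$ such that $f(x)$ is the number of accepting computation paths on input $x$ of a fixed nondeterministic Turing machine with read-only input tape that uses $O(\log|x|)$ work space and halts on every computation path. Equivalently: there are a polynomial $q$ and a deterministic $O(\log|x|)$-space Turing machine $M$ with an additional read-once, left-to-right witness tape such that $f(x)=\#\{w\in\Sigma^{q(|x|)}\mid M(x,w)=\mathsf{yes}\}$.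 *)

theory Defs
  imports Complex_Main "HOL-Library.FuncSet" "HOL-Library.Landau_Symbols"
begin

section \<open>Partitions and semistandard Young tableaux\<close>

text \<open>A partition is the weakly decreasing list of its (positive) parts, so the number of parts
  is the length of the list.\<close>

definition is_partition :: "nat list \<Rightarrow> bool" where
  "is_partition l \<longleftrightarrow> sorted_wrt (\<ge>) l \<and> 0 \<notin> set l"

definition young_diagram :: "nat list \<Rightarrow> (nat \<times> nat) set" where
  "young_diagram l = {(i, j). 1 \<le> i \<and> i \<le> length l \<and> 1 \<le> j \<and> j \<le> l ! (i - 1)}"

text \<open>The extensional function space makes a tableau determined by its values on the diagram.\<close>

definition SSYT :: "nat \<Rightarrow> nat list \<Rightarrow> (nat \<times> nat \<Rightarrow> nat) set" where
  "SSYT N l = {T \<in> young_diagram l \<rightarrow>\<^sub>E {1..N}.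
     (\<forall>i j. (i, j) \<in> young_diagram l \<longrightarrow> (i, j + 1) \<in> young_diagram l \<longrightarrow> T (i, j) \<le> T (i, j + 1)) \<and>
     (\<forall>i j. (i, j) \<in> young_diagram l \<longrightarrow> (i + 1, j) \<in> young_diagram l \<longrightarrow> T (i, j) < T (i + 1, j))}"


section \<open>Nondeterministic Turing machines with a read-only input tape\<close>

text \<open>Strings over the alphabet 0, 1 are boolean lists; \<^term>\<open>True\<close> is the letter 1. On input
  \<open>x\<close> the input tape has the cells \<open>0, \<dots>, |x| + 1\<close>, the two outermost ones holding end markers.\<close>

datatype input_symbol = LeftEnd | RightEnd | Bit bool

definition input_at :: "bool list \<Rightarrow> nat \<Rightarrow> input_symbol" where
  "input_at x p = (if p = 0 then LeftEnd else if p \<le> length x then Bit (x ! (p - 1)) else RightEnd)"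

datatype head_move = MoveLeft | Stay | MoveRight

primrec move_head :: "head_move \<Rightarrow> nat \<Rightarrow> nat" where
  "move_head MoveLeft p = p - 1"
| "move_head Stay p = p"
| "move_head MoveRight p = Suc p"

text \<open>An action consists of the new state, the move of the input head and, for each work tape, the
  symbol to be written and the move of the head. The machine is given by its transition table; as
  the table has to be finite, only finitely many states and work tape symbols are ever used.\<close>

type_synonym ('q, 'g) action = "'q \<times> head_move \<times> ('g \<times> head_move) list"

record ('q, 'g) ntm =
  num_tapes :: nat
  blank :: 'g
  start :: 'q
  accepting :: "'q set"
  transitions :: "(('q \<times> input_symbol \<times> 'g list) \<times> ('q, 'g) action) set"

definition wf_ntm :: "('q, 'g) ntm \<Rightarrow> bool" where
  "wf_ntm M \<longleftrightarrow> finite (transitions M) \<and>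
     (\<forall>q a gs q' m acts. ((q, a, gs), (q', m, acts)) \<in> transitions M \<longrightarrow>
        length gs = num_tapes M \<and> length acts = num_tapes M)"

text \<open>A work tape is infinite to the right, with cells indexed by the natural numbers, and is
  represented by its contents and its head position.\<close>

record ('q, 'g) config =
  state :: 'q
  input_head :: nat
  work_tapes :: "((nat \<Rightarrow> 'g) \<times> nat) list"

definition initial_config :: "('q, 'g) ntm \<Rightarrow> ('q, 'g) config" where
  "initial_config M =
     \<lparr>state = start M, input_head = 0, work_tapes = replicate (num_tapes M) (\<lambda>_. blank M, 0)\<rparr>"

definition enabled :: "('q, 'g) ntm \<Rightarrow> bool list \<Rightarrow> ('q, 'g) config \<Rightarrow> ('q, 'g) action set" where
  "enabled M x c =
     transitions M `` {(state c, input_at x (input_head c), map (\<lambda>(t, p). t p) (work_tapes c))}"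

definition apply_action :: "bool list \<Rightarrow> ('q, 'g) action \<Rightarrow> ('q, 'g) config \<Rightarrow> ('q, 'g) config" where
  "apply_action x a c = (case a of (q, m, acts) \<Rightarrow>
     \<lparr>state = q,
      input_head = min (length x + 1) (move_head m (input_head c)),
      work_tapes = map2 (\<lambda>(t, p) (g, d). (t(p := g), move_head d p)) (work_tapes c) acts\<rparr>)"

text \<open>A computation path is recorded by the sequence of actions chosen along it, so that two paths
  are different iff they branch at some point.\<close>

inductive run :: "('q, 'g) ntm \<Rightarrow> bool list \<Rightarrow> ('q, 'g) config \<Rightarrow> ('q, 'g) action list
    \<Rightarrow> ('q, 'g) config \<Rightarrow> bool" for M x where
  run_Nil: "run M x c [] c"
| run_Cons: "a \<in> enabled M x c \<Longrightarrow> run M x (apply_action x a c) as d \<Longrightarrow> run M x c (a # as) d"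

definition accepting_paths :: "('q, 'g) ntm \<Rightarrow> bool list \<Rightarrow> ('q, 'g) action list set" where
  "accepting_paths M x =
     {as. \<exists>d. run M x (initial_config M) as d \<and> enabled M x d = {} \<and> state d \<in> accepting M}"

definition halts_on_all_paths :: "('q, 'g) ntm \<Rightarrow> bool list \<Rightarrow> bool" where
  "halts_on_all_paths M x \<longleftrightarrow>
     \<not> (\<exists>c. c 0 = initial_config M \<and>
           (\<forall>i. \<exists>a \<in> enabled M x (c i). c (Suc i) = apply_action x a (c i)))"

text \<open>As the heads start at cell 0 and move by single cells, a work tape whose head always stays
  below \<open>s\<close> uses at most \<open>s\<close> cells. The number of work tapes is constant, so bounding each of
  them by \<open>O(log |x|)\<close> bounds the total work space by \<open>O(log |x|)\<close>.\<close>

definition uses_space :: "('q, 'g) ntm \<Rightarrow> bool list \<Rightarrow> nat \<Rightarrow> bool" where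
  "uses_space M x s \<longleftrightarrow>
     (\<forall>as d. run M x (initial_config M) as d \<longrightarrow> (\<forall>(t, p) \<in> set (work_tapes d). p < s))"

text \<open>States and work tape symbols are natural numbers, which is no restriction for finite
  transition tables. The sets counted here are finite, see \<open>finite_accepting_paths\<close> below.\<close>

definition sharp_L :: "(bool list \<Rightarrow> nat) set" where
  "sharp_L = {f. \<exists>(M :: (nat, nat) ntm) (s :: nat \<Rightarrow> nat).
     wf_ntm M \<and>
     (\<lambda>n. real (s n)) \<in> O(\<lambda>n. ln (real n)) \<and>
     (\<forall>x. halts_on_all_paths M x \<and> uses_space M x (s (length x)) \<and>
          f x = card (accepting_paths M x))}"

lemma finite_accepting_paths:
  assumes "wf_ntm M" and "halts_on_all_paths M x"
  shows "finite (accepting_paths M x)"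
proof (rule ccontr)
  define P where "P c = {as. \<exists>d. run M x c as d \<and> enabled M x d = {} \<and> state d \<in> accepting M}" for c
  have fin: "finite (enabled M x c)" for c
    using assms(1) by (auto simp: wf_ntm_def enabled_def)
  have step: "\<exists>a \<in> enabled M x c. infinite (P (apply_action x a c))" if "infinite (P c)" for c
  proof (rule ccontr)
    assume "\<not> ?thesis"
    then have "finite (insert [] (\<Union>a \<in> enabled M x c. (#) a ` P (apply_action x a c)))"
      using fin by auto
    moreover have "P c \<subseteq> insert [] (\<Union>a \<in> enabled M x c. (#) a ` P (apply_action x a c))"
    proof
      fix as
      assume "as \<in> P c"
      then obtain d where "run M x c as d" "enabled M x d = {}" "state d \<in> accepting M"
        by (auto simp: P_def)
      then show "as \<in> insert [] (\<Union>a \<in> enabled M x c. (#) a ` P (apply_action x a c))"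
        by (cases rule: run.cases) (auto simp: P_def)
    qed
    ultimately show False using that finite_subset by blast
  qed
  assume "infinite (accepting_paths M x)"
  then have inf: "infinite (P (initial_config M))"
    by (simp add: P_def accepting_paths_def)
  have "\<exists>c. \<forall>i. (infinite (P (c i)) \<and> (i = 0 \<longrightarrow> c i = initial_config M)) \<and>
      (\<exists>a \<in> enabled M x (c i). c (Suc i) = apply_action x a (c i))"
  proof (intro dependent_nat_choice)
    show "\<exists>c. infinite (P c) \<and> ((0::nat) = 0 \<longrightarrow> c = initial_config M)"
      using inf by blast
  next
    fix c and i :: nat
    assume "infinite (P c) \<and> (i = 0 \<longrightarrow> c = initial_config M)"
    then obtain a where "a \<in> enabled M x c" "infinite (P (apply_action x a c))"
      using step by blast
    then show "\<exists>d. (infinite (P d) \<and> (Suc i = 0 \<longrightarrow> d = initial_config M)) \<and>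
        (\<exists>a \<in> enabled M x c. d = apply_action x a c)"
      by auto
  qed
  with assms(2) show False
    unfolding halts_on_all_paths_def by blast
qed


section \<open>Unary encoding\<close>

definition encode :: "nat \<times> nat list \<Rightarrow> bool list" where
  "encode = (\<lambda>(N, l). replicate N True @ concat (map (\<lambda>p. False # replicate p True) l))"

definition zero_extension :: "('a \<Rightarrow> bool list) \<Rightarrow> 'a set \<Rightarrow> ('a \<Rightarrow> nat) \<Rightarrow> bool list \<Rightarrow> nat" where
  "zero_extension enc D v w = (if w \<in> enc ` D then v (inv_into D enc w) else 0)"

lemma zero_extension_outside: "w \<notin> enc ` D \<Longrightarrow> zero_extension enc D v w = 0"
  by (simp add: zero_extension_def)

lemma zero_extension_encode: "inj_on enc D \<Longrightarrow> a \<in> D \<Longrightarrow> zero_extension enc D v (enc a) = v a"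
  by (simp add: zero_extension_def)

lemma inj_encode: "inj encode"
proof -
  have "N = N' \<and> l = l'" if "encode (N, l) = encode (N', l')" for N N' l l'
    using that
  proof (induction l arbitrary: N N' l')
    case Nil
    then have "False \<notin> set (encode (N', l'))"
      by (metis encode_def case_prod_conv concat.simps(1) list.simps(8) append_Nil2 in_set_replicate)
    then have "l' = []" by (cases l') (auto simp: encode_def)
    with Nil show ?case by (simp add: encode_def)
  next
    case (Cons p l)
    have tw: "takeWhile id (encode (N, q # r)) = replicate N True"
      and dw: "dropWhile id (encode (N, q # r)) = False # encode (q, r)" for N q r
      by (induction N) (auto simp: encode_def)
    have "False \<in> set (encode (N', l'))"
      by (subst Cons.prems [symmetric]) (simp add: encode_def)
    then obtain q r where l': "l' = q # r"
      by (cases l') (auto simp: encode_def)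
    have "N = N'" using Cons.prems tw unfolding l' by (metis length_replicate)
    moreover have "encode (p, l) = encode (q, r)"
      using Cons.prems dw unfolding l' by (metis list.inject)
    ultimately show ?case using Cons.IH l' by blast
  qed
  then show ?thesis by (auto intro!: injI)
qed

end

theory Submission
  imports Defs "HOL-Library.Countable"
begin

text \<open>
  A semistandard tableau with entries at most \<open>N\<close> is taken apart by removing the cells
  with entry \<open>N\<close>, then those with entry \<open>N - 1\<close>, and so on. A shape with at most \<open>C\<close> rows is
  stored as the list \<open>v 1, \<dots>, v C\<close> of the differences of consecutive row lengths, and a shape with
  at most \<open>C\<close> columns likewise by the differences of consecutive column lengths. Removing the last
  cell of row (column) \<open>i\<close> is possible iff \<open>v i > 0\<close>, and it moves one unit from \<open>v i\<close> to
  \<open>v (i - 1)\<close>.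

  The cells of the largest entry form a horizontal strip, which a machine with \<open>C + 3\<close> counters
  guesses cell by cell, in such an order that each strip is guessed on exactly one path. For rows,
  \<open>i\<close> runs upwards from 1 to \<open>C\<close>, and as long as \<open>v i > 0\<close> the machine chooses between removing
  another cell of row \<open>i\<close> and proceeding to the next row. For columns, \<open>i\<close> runs downwards from
  \<open>C\<close> to 1, and at most one cell of each column is removed. After \<open>N\<close> such sweeps the machine
  accepts iff the shape is empty. The number of accepting paths from each intermediate
  configuration is the number of tableaux of the current shape in which the largest value occurs
  only in the rows (columns) not yet swept; the recursion that this number has to satisfy comes from
  removing a single corner, lemma \<open>card_tableaux_corner\<close>, in the forms \<open>rows_sweep_pos\<close> and
  \<open>cols_sweep_pos\<close>. The differences are computed while the input is read, which also checks that
  the input encodes an admissible pair.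

  All counters are bounded by the input length plus 1. A Turing machine keeps each of them in
  binary on a work tape of its own, so that it needs only logarithmic space; the
  increments, decrements and zero tests are deterministic and hence preserve the number of accepting
  paths (\<open>simulation\<close>, \<open>sharp_L_if_computes\<close>).
\<close>

section \<open>Counting the accepting paths of a machine\<close>

text \<open>All work tape heads are at cells below \<open>s\<close>.\<close>

definition heads_below :: "nat \<Rightarrow> ('q, 'g) config \<Rightarrow> bool" where
  "heads_below s c \<longleftrightarrow> (\<forall>(t, p) \<in> set (work_tapes c). p < s)"

text \<open>\<open>counted M x s c k\<close>: every computation path from \<open>c\<close> halts, the work tape heads stay
  below \<open>s\<close> on all of them, and exactly \<open>k\<close> of them accept.\<close>

inductive counted :: "('q, 'g) ntm \<Rightarrow> bool list \<Rightarrow> nat \<Rightarrow> ('q, 'g) config \<Rightarrow> nat \<Rightarrow> bool"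
  for M x s where
  leaf: "enabled M x c = {} \<Longrightarrow> heads_below s c
    \<Longrightarrow> counted M x s c (if state c \<in> accepting M then 1 else 0)"
| branch: "enabled M x c \<noteq> {} \<Longrightarrow> finite (enabled M x c) \<Longrightarrow> heads_below s c
    \<Longrightarrow> (\<And>a. a \<in> enabled M x c \<Longrightarrow> counted M x s (apply_action x a c) (f a))
    \<Longrightarrow> counted M x s c (\<Sum>a \<in> enabled M x c. f a)"

text \<open>The computation paths that start in an arbitrary configuration \<open>c\<close> and accept.\<close>

definition paths_from :: "('q, 'g) ntm \<Rightarrow> bool list \<Rightarrow> ('q, 'g) config \<Rightarrow> ('q, 'g) action list set" where
  "paths_from M x c = {as. \<exists>d. run M x c as d \<and> enabled M x d = {} \<and> state d \<in> accepting M}"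

lemma paths_from_leaf:
  assumes "enabled M x c = {}"
  shows "paths_from M x c = (if state c \<in> accepting M then {[]} else {})"
proof -
  have "run M x c as d \<longleftrightarrow> as = [] \<and> d = c" for as d
    using assms by (auto intro: run.intros elim: run.cases)
  then show ?thesis using assms by (auto simp: paths_from_def)
qed

lemma paths_from_branch:
  assumes "enabled M x c \<noteq> {}"
  shows "paths_from M x c = (\<Union>a \<in> enabled M x c. (#) a ` paths_from M x (apply_action x a c))"
proof (intro equalityI subsetI)
  fix as
  assume "as \<in> paths_from M x c"
  then obtain d where "run M x c as d" "enabled M x d = {}" "state d \<in> accepting M"
    by (auto simp: paths_from_def)
  then show "as \<in> (\<Union>a \<in> enabled M x c. (#) a ` paths_from M x (apply_action x a c))"
    using assms by (cases rule: run.cases) (auto simp: paths_from_def)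
qed (auto simp: paths_from_def intro: run.intros)

lemma counted_card: "counted M x s c k \<Longrightarrow> finite (paths_from M x c) \<and> card (paths_from M x c) = k"
proof (induction rule: counted.induct)
  case (leaf c)
  then show ?case by (simp add: paths_from_leaf)
next
  case (branch c f)
  let ?P = "\<lambda>a. (#) a ` paths_from M x (apply_action x a c)"
  have "card (\<Union>a \<in> enabled M x c. ?P a) = (\<Sum>a \<in> enabled M x c. card (?P a))"
    using branch by (intro card_UN_disjoint) auto
  also have "\<dots> = (\<Sum>a \<in> enabled M x c. f a)"
    using branch by (intro sum.cong) (auto simp: card_image)
  finally show ?case
    using branch by (simp add: paths_from_branch)
qed

lemma counted_space: "run M x c as d \<Longrightarrow> counted M x s c k \<Longrightarrow> heads_below s d"
proof (induction arbitrary: k rule: run.induct)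
  case (run_Nil c)
  then show ?case by (auto elim: counted.cases)
next
  case (run_Cons a c as d)
  from run_Cons.prems obtain k' where "counted M x s (apply_action x a c) k'"
  proof (cases rule: counted.cases)
    case leaf
    then show ?thesis using run_Cons.hyps(1) by simp
  next
    case (branch f)
    show ?thesis by (rule that, rule branch(5), rule run_Cons.hyps(1))
  qed
  then show ?case by (rule run_Cons.IH)
qed

lemma counted_halts:
  "counted M x s c k \<Longrightarrow> g (0::nat) = c
    \<Longrightarrow> \<forall>i. \<exists>a \<in> enabled M x (g i). g (Suc i) = apply_action x a (g i) \<Longrightarrow> False"
proof (induction arbitrary: g rule: counted.induct)
  case (leaf c)
  then show ?case by (metis empty_iff)
next
  case (branch c f)
  from branch.prems obtain a where a: "a \<in> enabled M x c" "g (Suc 0) = apply_action x a c"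
    by blast
  show ?case
    by (rule branch.IH [OF a(1), of "\<lambda>i. g (Suc i)"]) (use a branch.prems in auto)
qed

text \<open>Membership in the class \<open>#L\<close> thus follows from a single derivation of \<open>counted\<close> for each input.\<close>

lemma sharp_L_I:
  fixes M :: "(nat, nat) ntm"
  assumes "wf_ntm M" and "(\<lambda>n. real (s n)) \<in> O(\<lambda>n. ln (real n))"
    and "\<And>x. counted M x (s (length x)) (initial_config M) (f x)"
  shows "f \<in> sharp_L"
proof -
  have "halts_on_all_paths M x" for x
    using counted_halts [OF assms(3)] unfolding halts_on_all_paths_def by blast
  moreover have "uses_space M x (s (length x))" for x
    using counted_space [OF _ assms(3)] by (fastforce simp: uses_space_def heads_below_def)
  moreover have "f x = card (accepting_paths M x)" for x
    using counted_card [OF assms(3), of x] by (simp add: accepting_paths_def paths_from_def)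
  ultimately show ?thesis
    unfolding sharp_L_def using assms(1,2) by blast
qed

text \<open>Configurations with a unique successor keep the number of accepting paths; a binary choice adds the
  numbers of the two branches.\<close>

lemma counted_step:
  assumes "enabled M x c = {a}" and "heads_below s c" and "counted M x s (apply_action x a c) k"
  shows "counted M x s c k"
  using branch [where f = "\<lambda>_. k", of M x c s] assms by simp

lemma counted_choice:
  assumes "enabled M x c = {a, b}" and "a \<noteq> b" and "heads_below s c"
    and "counted M x s (apply_action x a c) k" and "counted M x s (apply_action x b c) l"
  shows "counted M x s c (k + l)"
proof -
  have "counted M x s c (\<Sum>d \<in> enabled M x c. if d = a then k else l)"
  proof (rule branch)
    fix d
    assume "d \<in> enabled M x c"
    then consider "d = a" | "d = b" using assms(1) by blast
    then show "counted M x s (apply_action x d c) (if d = a then k else l)"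
      by cases (use assms in simp_all)
  qed (use assms in simp_all)
  then show ?thesis using assms(1,2) by simp
qed


section \<open>Binary counters\<close>

text \<open>Numbers are written in binary with the least significant digit first; leading zeros are
  allowed.\<close>

fun value_of :: "bool list \<Rightarrow> nat" where
  "value_of [] = 0"
| "value_of (b # bs) = of_bool b + 2 * value_of bs"

text \<open>The successor, and the predecessor of a positive number. On a number that is zero the value of
  \<open>decr\<close> has no meaning.\<close>

fun incr :: "bool list \<Rightarrow> bool list" where
  "incr [] = [True]"
| "incr (False # bs) = True # bs"
| "incr (True # bs) = False # incr bs"

fun decr :: "bool list \<Rightarrow> bool list" where
  "decr [] = []"
| "decr (True # bs) = False # bs"
| "decr (False # bs) = True # decr bs"

lemma value_of_incr [simp]: "value_of (incr bs) = Suc (value_of bs)"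
  by (induction bs rule: incr.induct) auto

lemma value_of_decr [simp]: "value_of (decr bs) = value_of bs - 1" if "value_of bs > 0"
  using that by (induction bs rule: decr.induct) auto

lemma length_decr [simp]: "length (decr bs) = length bs"
  by (induction bs rule: decr.induct) auto

text \<open>An increment lengthens the representation only if the new value is a power of two, so a
  counter whose values stay below \<open>B\<close> has at most logarithmically many digits.\<close>

lemma length_incr: "length (incr bs) = length bs \<or>
    length (incr bs) = Suc (length bs) \<and> Suc (value_of bs) = 2 ^ length bs"
  by (induction bs rule: incr.induct) auto

text \<open>The tape alphabet consists of the digits 0 and 1, the blank 2 and the symbol 3 that marks
  cell 0. The digits start at cell 1.\<close>

definition tape :: "bool list \<Rightarrow> nat \<Rightarrow> nat" where
  "tape bs p = (if p = 0 then 3 else if p \<le> length bs then of_bool (bs ! (p - 1)) else 2)"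

lemma tape_0 [simp]: "tape bs 0 = 3"
  by (simp add: tape_def)

lemma tape_mid [simp]: "tape (us @ b # bs) (Suc (length us)) = of_bool b"
  by (simp add: tape_def)

lemma tape_end [simp]: "tape bs (Suc (length bs)) = 2"
  by (simp add: tape_def)

lemma tape_less_4: "tape bs p < 4"
  by (simp add: tape_def)

lemma tape_update_mid: "(tape (us @ b # bs))(Suc (length us) := of_bool d) = tape (us @ d # bs)"
  by (auto simp: tape_def fun_eq_iff nth_append)

lemma tape_update_end: "(tape us)(Suc (length us) := Suc 0) = tape (us @ [True])"
  by (auto simp: tape_def fun_eq_iff nth_append)


section \<open>Counter machines in logarithmic space\<close>

text \<open>A counter machine has finitely many counters holding natural numbers and reads its input
  once, from left to right. \<open>Read q1 q0 qe\<close> branches on the next letter, the last target being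
  taken at the end of the input. \<open>Choose\<close> is the only nondeterministic instruction.\<close>

datatype 'q instr =
  Accept | Reject | Goto 'q | Inc nat 'q | Dec nat 'q | IfZero nat 'q 'q | Choose 'q 'q
| Read 'q 'q 'q

fun counters_of :: "'q instr \<Rightarrow> nat set" where
  "counters_of (Inc i q) = {i}"
| "counters_of (Dec i q) = {i}"
| "counters_of (IfZero i q r) = {i}"
| "counters_of _ = {}"

text \<open>\<open>computes prog B q w v k\<close>: started in state \<open>q\<close> with the remaining input \<open>w\<close> and the counter
  values \<open>v\<close>, the program halts on all computation paths without incrementing a counter
  beyond \<open>B\<close> or decrementing a counter that is zero, and it accepts on exactly \<open>k\<close> of the
  paths.\<close>

inductive computes :: "('q \<Rightarrow> 'q instr) \<Rightarrow> nat \<Rightarrow> 'q \<Rightarrow> bool list \<Rightarrow> (nat \<Rightarrow> nat) \<Rightarrow> nat \<Rightarrow> bool"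
  for prog B where
  computes_Accept: "prog q = Accept \<Longrightarrow> computes prog B q w v 1"
| computes_Reject: "prog q = Reject \<Longrightarrow> computes prog B q w v 0"
| computes_Goto: "prog q = Goto r \<Longrightarrow> computes prog B r w v k \<Longrightarrow> computes prog B q w v k"
| computes_Inc: "prog q = Inc i r \<Longrightarrow> v i < B \<Longrightarrow> computes prog B r w (v(i := Suc (v i))) k
    \<Longrightarrow> computes prog B q w v k"
| computes_Dec: "prog q = Dec i r \<Longrightarrow> v i > 0 \<Longrightarrow> computes prog B r w (v(i := v i - 1)) k
    \<Longrightarrow> computes prog B q w v k"
| computes_IfZero: "prog q = IfZero i r r' \<Longrightarrow> computes prog B (if v i = 0 then r else r') w v k
    \<Longrightarrow> computes prog B q w v k"
| computes_Choose: "prog q = Choose r r' \<Longrightarrow> r \<noteq> r' \<Longrightarrow> computes prog B r w v k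
    \<Longrightarrow> computes prog B r' w v l \<Longrightarrow> computes prog B q w v (k + l)"
| computes_Read_end: "prog q = Read r r' r'' \<Longrightarrow> computes prog B r'' [] v k
    \<Longrightarrow> computes prog B q [] v k"
| computes_Read: "prog q = Read r r' r'' \<Longrightarrow> computes prog B (if b then r else r') w v k
    \<Longrightarrow> computes prog B q (b # w) v k"

text \<open>The states of the simulating Turing machine. Between two instructions, in a state
  \<open>Main q\<close>, all work tape heads are at cell 0. In a state \<open>Carry i q\<close>, \<open>Borrow i q\<close> or
  \<open>Test i q r\<close> the head of tape \<open>i\<close> moves to the right and adds 1, subtracts 1, or looks for a
  nonzero digit; in a state \<open>Back i q\<close> it returns to cell 0, whereupon the simulation goes on
  at \<open>q\<close>.\<close>

datatype 'q control =
  Init | Main 'q | Carry nat 'q | Borrow nat 'q | Test nat 'q 'q | Back nat 'q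

instance control :: (countable) countable
  by countable_datatype

text \<open>Actions on the work tapes, given the symbols \<open>gs\<close> that are read: \<open>hold\<close> rewrites all of them and
  moves no head, \<open>on_tape i g d\<close> differs from it by writing \<open>g\<close> on tape \<open>i\<close> and moving its head in
  direction \<open>d\<close>.\<close>

definition hold :: "nat list \<Rightarrow> (nat \<times> head_move) list" where
  "hold gs = map (\<lambda>g. (g, Stay)) gs"

definition on_tape :: "nat \<Rightarrow> nat \<Rightarrow> head_move \<Rightarrow> nat list \<Rightarrow> (nat \<times> head_move) list" where
  "on_tape i g d gs = (hold gs)[i := (g, d)]"

lemma length_hold [simp]: "length (hold gs) = length gs"
  by (simp add: hold_def)

lemma length_on_tape [simp]: "length (on_tape i g d gs) = length gs"
  by (simp add: on_tape_def)

text \<open>A program using the counters below \<open>K\<close>, whose control stays in the finite set \<open>Q\<close>.\<close>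

locale counter_machine =
  fixes prog :: "'q::countable \<Rightarrow> 'q instr" and Q :: "'q set" and K :: nat and q0 :: 'q
  assumes finite_Q: "finite Q"
    and start_in_Q: "q0 \<in> Q"
    and closed: "q \<in> Q \<Longrightarrow> set_instr (prog q) \<subseteq> Q"
    and counters: "q \<in> Q \<Longrightarrow> counters_of (prog q) \<subseteq> {..<K}"
begin

text \<open>The first action of the simulation of an instruction. An operation on counter \<open>i\<close> starts by moving
  the head of tape \<open>i\<close> from the marker, which is written again, to the least significant digit.\<close>

fun first_step :: "'q instr \<Rightarrow> input_symbol \<Rightarrow> nat list
    \<Rightarrow> ('q control \<times> head_move \<times> (nat \<times> head_move) list) list" where
  "first_step Accept a gs = []"
| "first_step Reject a gs = []"
| "first_step (Goto q) a gs = [(Main q, Stay, hold gs)]"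
| "first_step (Inc i q) a gs = [(Carry i q, Stay, on_tape i 3 MoveRight gs)]"
| "first_step (Dec i q) a gs = [(Borrow i q, Stay, on_tape i 3 MoveRight gs)]"
| "first_step (IfZero i q r) a gs = [(Test i q r, Stay, on_tape i 3 MoveRight gs)]"
| "first_step (Choose q r) a gs = [(Main q, Stay, hold gs), (Main r, Stay, hold gs)]"
| "first_step (Read q r r') a gs =
    [(case a of Bit b \<Rightarrow> (Main (if b then q else r), MoveRight, hold gs)
      | _ \<Rightarrow> (Main r', Stay, hold gs))]"

text \<open>The possible actions of the simulating machine. Only \<open>Choose\<close> offers more than one. A blank is
  treated as the digit 0 when a carry arrives at it, and it ends a zero test.\<close>

fun delta :: "'q control \<Rightarrow> input_symbol \<Rightarrow> nat list
    \<Rightarrow> ('q control \<times> head_move \<times> (nat \<times> head_move) list) list" where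
  "delta Init a gs = [(Main q0, MoveRight, map (\<lambda>_. (3, Stay)) gs)]"
| "delta (Main q) a gs = first_step (prog q) a gs"
| "delta (Carry i q) a gs =
    [if gs ! i = 1 then (Carry i q, Stay, on_tape i 0 MoveRight gs)
     else (Back i q, Stay, on_tape i 1 MoveLeft gs)]"
| "delta (Borrow i q) a gs =
    [if gs ! i = 0 then (Borrow i q, Stay, on_tape i 1 MoveRight gs)
     else (Back i q, Stay, on_tape i 0 MoveLeft gs)]"
| "delta (Test i q r) a gs =
    [if gs ! i = 0 then (Test i q r, Stay, on_tape i 0 MoveRight gs)
     else if gs ! i = 1 then (Back i r, Stay, on_tape i 1 MoveLeft gs)
     else (Back i q, Stay, on_tape i 2 MoveLeft gs)]"
| "delta (Back i q) a gs =
    [if gs ! i = 3 then (Main q, Stay, hold gs)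
     else (Back i q, Stay, on_tape i (gs ! i) MoveLeft gs)]"

text \<open>The control states that can occur; there are finitely many since \<open>Q\<close> is finite.\<close>

definition states :: "'q control set" where
  "states = {Init} \<union> Main ` Q \<union> (\<Union>i \<in> {..<K}. Carry i ` Q \<union> Borrow i ` Q \<union> Back i ` Q \<union>
     (\<Union>q \<in> Q. Test i q ` Q))"

text \<open>The simulating Turing machine, with its control states numbered by \<open>to_nat\<close>.\<close>

definition machine :: "(nat, nat) ntm" where
  "machine = \<lparr>num_tapes = K, blank = 2, start = to_nat (Init :: 'q control),
     accepting = to_nat ` Main ` {q. prog q = Accept},
     transitions = {((to_nat s, a, gs), (to_nat s', m, acts)) | s a gs s' m acts.
        s \<in> states \<and> length gs = K \<and> set gs \<subseteq> {..<4} \<and> (s', m, acts) \<in> set (delta s a gs)}\<rparr>"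

lemma finite_states: "finite states"
  using finite_Q by (simp add: states_def)

lemma in_states [simp]:
  "Init \<in> states"
  "Main q \<in> states \<longleftrightarrow> q \<in> Q"
  "Carry i q \<in> states \<longleftrightarrow> i < K \<and> q \<in> Q"
  "Borrow i q \<in> states \<longleftrightarrow> i < K \<and> q \<in> Q"
  "Back i q \<in> states \<longleftrightarrow> i < K \<and> q \<in> Q"
  "Test i q r \<in> states \<longleftrightarrow> i < K \<and> q \<in> Q \<and> r \<in> Q"
  by (auto simp: states_def image_iff)

lemma length_first_step: "(s', m, acts) \<in> set (first_step I a gs) \<Longrightarrow> length acts = length gs"
  by (cases I) (auto split: input_symbol.splits)

lemma length_delta: "(s', m, acts) \<in> set (delta s a gs) \<Longrightarrow> length acts = length gs"
  by (cases s) (auto dest: length_first_step split: if_splits)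

lemma wf_machine: "wf_ntm machine"
proof -
  have "UNIV = {LeftEnd, RightEnd, Bit True, Bit False}"
    by (auto intro: input_symbol.exhaust)
  then have fin: "finite (UNIV :: input_symbol set)"
    by (metis finite.emptyI finite.insertI)
  define X where "X = states \<times> (UNIV :: input_symbol set) \<times> {gs. set gs \<subseteq> {..<4::nat} \<and> length gs = K}"
  have "finite X"
    unfolding X_def using finite_states fin by (simp add: finite_lists_length_eq)
  then have "finite (\<Union>(s, a, gs) \<in> X.
      (\<lambda>(s', m, acts). ((to_nat s, a, gs), (to_nat s', m, acts))) ` set (delta s a gs))"
    (is "finite ?T") by auto
  moreover have "transitions machine \<subseteq> ?T"
  proof
    fix z
    assume "z \<in> transitions machine"
    then obtain s a gs s' m acts where z: "z = ((to_nat s, a, gs), (to_nat s', m, acts))"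
      and "(s, a, gs) \<in> X" and "(s', m, acts) \<in> set (delta s a gs)"
      by (auto simp: machine_def X_def)
    then show "z \<in> ?T"
      by (intro UN_I [of "(s, a, gs)"]) (auto intro!: image_eqI [of _ _ "(s', m, acts)"])
  qed
  ultimately have "finite (transitions machine)"
    by (rule rev_finite_subset)
  then show ?thesis
    by (auto simp: wf_ntm_def machine_def dest: length_delta)
qed

text \<open>\<open>D i\<close> is the digit list on tape \<open>i\<close>. In \<open>rest_config s h D\<close> all work tape heads are at cell 0; in
  \<open>op_config s h D i t p\<close> tape \<open>i\<close> has been replaced by the tape with contents \<open>t\<close> and head
  position \<open>p\<close>. The input head is at cell \<open>h\<close>.\<close>

definition at_rest :: "(nat \<Rightarrow> bool list) \<Rightarrow> ((nat \<Rightarrow> nat) \<times> nat) list" where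
  "at_rest D = map (\<lambda>j. (tape (D j), 0)) [0..<K]"

definition rest_config :: "'q control \<Rightarrow> nat \<Rightarrow> (nat \<Rightarrow> bool list) \<Rightarrow> (nat, nat) config" where
  "rest_config s h D = \<lparr>state = to_nat s, input_head = h, work_tapes = at_rest D\<rparr>"

definition op_config :: "'q control \<Rightarrow> nat \<Rightarrow> (nat \<Rightarrow> bool list) \<Rightarrow> nat \<Rightarrow> (nat \<Rightarrow> nat) \<Rightarrow> nat
    \<Rightarrow> (nat, nat) config" where
  "op_config s h D i t p =
     \<lparr>state = to_nat s, input_head = h, work_tapes = (at_rest D)[i := (t, p)]\<rparr>"

lemma op_config_rest: "i < K \<Longrightarrow> op_config s h D i (tape bs) 0 = rest_config s h (D(i := bs))"
  by (auto simp: op_config_def rest_config_def at_rest_def list_eq_iff_nth_eq nth_list_update)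

lemma enabled_machine:
  assumes "state c = to_nat s" and "s \<in> states"
    and "gs = map (\<lambda>(t, p). t p) (work_tapes c)" and "length gs = K" and "set gs \<subseteq> {..<4}"
  shows "enabled machine x c =
    (\<lambda>(s', m, acts). (to_nat s', m, acts)) ` set (delta s (input_at x (input_head c)) gs)"
proof -
  let ?E = "set (delta s (input_at x (input_head c)) gs)"
  have "enabled machine x c = {(n, m, acts). \<exists>s'. n = to_nat s' \<and> (s', m, acts) \<in> ?E}"
    unfolding enabled_def Image_singleton assms(1) assms(3) [symmetric]
    using assms(2,4,5) by (auto simp: machine_def)
  also have "\<dots> = (\<lambda>(s', m, acts). (to_nat s', m, acts)) ` ?E"
    by (auto simp: image_iff split: prod.splits)
  finally show ?thesis .
qed

lemma rest_symbols: "map (\<lambda>(t, p). t p) (at_rest D) = replicate K 3"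
  by (simp add: at_rest_def list_eq_iff_nth_eq)

lemma op_symbols: "map (\<lambda>(t, p). t p) ((at_rest D)[i := (t, p)]) = (replicate K 3)[i := t p]"
  by (simp add: map_update rest_symbols)

lemma apply_hold_rest:
  "apply_action x (to_nat s', m, hold (replicate K 3)) (rest_config s h D) =
   rest_config s' (min (length x + 1) (move_head m h)) D"
  by (auto simp: apply_action_def rest_config_def hold_def at_rest_def list_eq_iff_nth_eq)

lemma apply_on_tape:
  "i < K \<Longrightarrow> h \<le> length x + 1 \<Longrightarrow>
   apply_action x (to_nat s', Stay, on_tape i g d ((replicate K 3)[i := r])) (op_config s h D i t p) =
   op_config s' h D i (t(p := g)) (move_head d p)"
  by (auto simp: apply_action_def op_config_def hold_def on_tape_def at_rest_def
      list_eq_iff_nth_eq nth_list_update)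

lemma heads_below_rest: "0 < s \<Longrightarrow> heads_below s (rest_config q h D)"
  by (auto simp: heads_below_def rest_config_def at_rest_def)

lemma heads_below_op: "p < s \<Longrightarrow> heads_below s (op_config q h D i t p)"
  by (auto simp: heads_below_def op_config_def at_rest_def
      dest!: set_update_subset_insert [THEN subsetD])

lemma op_step:
  assumes "i < K" and "h \<le> length x + 1" and "s \<in> states" and "t p < 4" and "p < b"
    and "delta s (input_at x h) ((replicate K 3)[i := t p]) =
      [(s', Stay, on_tape i g d ((replicate K 3)[i := t p]))]"
    and "counted machine x b (op_config s' h D i (t(p := g)) (move_head d p)) k"
  shows "counted machine x b (op_config s h D i t p) k"
proof (rule counted_step)
  have "set ((replicate K 3)[i := t p]) \<subseteq> {..<4}"
    using assms(4) by (auto dest!: set_update_subset_insert [THEN subsetD])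
  then show "enabled machine x (op_config s h D i t p) =
      {(to_nat s', Stay, on_tape i g d ((replicate K 3)[i := t p]))}"
    using assms by (subst enabled_machine [where s = s and gs = "(replicate K 3)[i := t p]"])
      (auto simp: op_config_def op_symbols)
qed (use assms in \<open>auto simp: apply_on_tape heads_below_op\<close>)

lemma enabled_rest:
  assumes "s \<in> states"
  shows "enabled machine x (rest_config s h D) =
    (\<lambda>(s', m, acts). (to_nat s', m, acts)) ` set (delta s (input_at x h) (replicate K 3))"
  using assms by (subst enabled_machine [where s = s and gs = "replicate K 3"])
    (auto simp: rest_config_def rest_symbols)

text \<open>The head movements of an operation: the return to cell 0, and the three scans, in which \<open>us\<close> are
  the digits to the left of the head and \<open>bs\<close> those still to be processed.\<close>

lemma Back_counted:
  assumes "i < K" and "h \<le> length x + 1" and "q \<in> Q" and "p < s" and "p \<le> Suc (length bs)"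
    and "counted machine x s (rest_config (Main q) h (D(i := bs))) k"
  shows "counted machine x s (op_config (Back i q) h D i (tape bs) p) k"
  using assms(4,5)
proof (induction p)
  case 0
  have mem: "Back i q \<in> states" using assms by simp
  have eq: "delta (Back i q) (input_at x h) (replicate K 3) = [(Main q, Stay, hold (replicate K 3))]"
    using assms(1) by simp
  show ?case
    unfolding op_config_rest [OF assms(1)]
  proof (rule counted_step)
    show "enabled machine x (rest_config (Back i q) h (D(i := bs))) =
        {(to_nat (Main q), Stay, hold (replicate K 3))}"
      by (simp only: enabled_rest [OF mem] eq) simp
  qed (use assms 0 in \<open>simp_all add: apply_hold_rest heads_below_rest\<close>)
next
  case (Suc p)
  have "tape bs (Suc p) \<noteq> 3"
    by (simp add: tape_def)
  with Suc assms(1-3) show ?case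
    by - (rule op_step [where s' = "Back i q" and g = "tape bs (Suc p)" and d = MoveLeft],
      auto simp: tape_less_4)
qed

lemma Carry_counted:
  assumes "i < K" and "h \<le> length x + 1" and "q \<in> Q" and "length (us @ incr bs) < s"
    and "counted machine x s (rest_config (Main q) h (D(i := us @ incr bs))) k"
  shows "counted machine x s (op_config (Carry i q) h D i (tape (us @ bs)) (Suc (length us))) k"
  using assms(4,5)
proof (induction bs arbitrary: us rule: incr.induct)
  case 1
  have "counted machine x s (op_config (Back i q) h D i (tape (us @ [True])) (length us)) k"
    using assms(1-3) 1 by (intro Back_counted) (auto simp: fun_upd_def)
  with 1 assms(1-3) show ?case
    by - (rule op_step [where s' = "Back i q" and g = 1 and d = MoveLeft],
      auto simp: tape_update_end)
next
  case (2 bs)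
  have "counted machine x s (op_config (Back i q) h D i (tape (us @ True # bs)) (length us)) k"
    using assms(1-3) 2 by (intro Back_counted) (auto simp: fun_upd_def)
  with 2 assms(1-3) show ?case
    by - (rule op_step [where s' = "Back i q" and g = 1 and d = MoveLeft],
      auto simp: tape_update_mid [where d = True, simplified])
next
  case (3 bs)
  have "counted machine x s
      (op_config (Carry i q) h D i (tape ((us @ [False]) @ bs)) (Suc (length (us @ [False])))) k"
    using 3 by (intro 3) (auto simp: fun_upd_def)
  with 3 assms(1-3) show ?case
    by - (rule op_step [where s' = "Carry i q" and g = 0 and d = MoveRight],
      auto simp: tape_update_mid [where d = False, simplified])
qed

lemma Borrow_counted:
  assumes "i < K" and "h \<le> length x + 1" and "q \<in> Q" and "length (us @ bs) < s"
    and "value_of bs > 0"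
    and "counted machine x s (rest_config (Main q) h (D(i := us @ decr bs))) k"
  shows "counted machine x s (op_config (Borrow i q) h D i (tape (us @ bs)) (Suc (length us))) k"
  using assms(4-6)
proof (induction bs arbitrary: us rule: decr.induct)
  case 1
  then show ?case by simp
next
  case (2 bs)
  have "counted machine x s (op_config (Back i q) h D i (tape (us @ False # bs)) (length us)) k"
    using assms(1-3) 2 by (intro Back_counted) (auto simp: fun_upd_def)
  with 2 assms(1-3) show ?case
    by - (rule op_step [where s' = "Back i q" and g = 0 and d = MoveLeft],
      auto simp: tape_update_mid [where d = False, simplified])
next
  case (3 bs)
  have "counted machine x s
      (op_config (Borrow i q) h D i (tape ((us @ [True]) @ bs)) (Suc (length (us @ [True])))) k"
    using 3 by (intro 3) (auto simp: fun_upd_def)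
  with 3 assms(1-3) show ?case
    by - (rule op_step [where s' = "Borrow i q" and g = 1 and d = MoveRight],
      auto simp: tape_update_mid [where d = True, simplified])
qed

lemma Test_counted:
  assumes "i < K" and "h \<le> length x + 1" and "q \<in> Q" and "r \<in> Q" and "Suc (length (us @ bs)) < s"
    and "counted machine x s
      (rest_config (Main (if value_of bs = 0 then q else r)) h (D(i := us @ bs))) k"
  shows "counted machine x s (op_config (Test i q r) h D i (tape (us @ bs)) (Suc (length us))) k"
  using assms(5,6)
proof (induction bs arbitrary: us)
  case Nil
  have "counted machine x s (op_config (Back i q) h D i (tape us) (length us)) k"
    using assms(1-4) Nil by (intro Back_counted) (auto simp: fun_upd_def)
  moreover have "(tape us)(Suc (length us) := 2) = tape us"
    by (metis fun_upd_triv tape_end)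
  ultimately show ?case
    using Nil assms(1-4)
    by - (rule op_step [where s' = "Back i q" and g = 2 and d = MoveLeft],
      auto)
next
  case (Cons b bs)
  show ?case
  proof (cases b)
    case True
    have "counted machine x s (op_config (Back i r) h D i (tape (us @ True # bs)) (length us)) k"
      using assms(1-4) Cons True by (intro Back_counted) (auto simp: fun_upd_def)
    with Cons True assms(1-4) show ?thesis
      by - (rule op_step [where s' = "Back i r" and g = 1 and d = MoveLeft],
        auto simp: tape_update_mid [where d = True, simplified])
  next
    case False
    have "counted machine x s
        (op_config (Test i q r) h D i (tape ((us @ [False]) @ bs)) (Suc (length (us @ [False])))) k"
      using Cons False by (intro Cons) (auto simp: fun_upd_def)
    with Cons False assms(1-4) show ?thesis
      by - (rule op_step [where s' = "Test i q r" and g = 0 and d = MoveRight],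
        auto simp: tape_update_mid [where d = False, simplified])
  qed
qed

lemma start_op:
  assumes "i < K" and "h \<le> length x + 1" and "q \<in> Q" and "s' \<in> states" and "1 < s"
    and "\<And>a gs. first_step (prog q) a gs = [(s', Stay, on_tape i 3 MoveRight gs)]"
    and "counted machine x s (op_config s' h D i (tape (D i)) 1) k"
  shows "counted machine x s (rest_config (Main q) h D) k"
proof -
  have "(tape (D i))(0 := 3) = tape (D i)"
    by (metis fun_upd_triv tape_0)
  with assms have "counted machine x s (op_config (Main q) h D i (tape (D i)) 0) k"
    by - (rule op_step [where s' = s' and g = 3 and d = MoveRight],
      auto)
  then show ?thesis
    using op_config_rest [OF assms(1), of "Main q" h D "D i"] by simp
qed

lemma rest_step:
  assumes "q \<in> Q" and "0 < s"
    and "first_step (prog q) (input_at x h) (replicate K 3) = [(Main r, m, hold (replicate K 3))]"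
    and "counted machine x s (rest_config (Main r) (min (length x + 1) (move_head m h)) D) k"
  shows "counted machine x s (rest_config (Main q) h D) k"
proof (rule counted_step)
  have mem: "Main q \<in> states" using assms by simp
  show "enabled machine x (rest_config (Main q) h D) = {(to_nat (Main r), m, hold (replicate K 3))}"
    using assms by (simp add: enabled_rest [OF mem])
qed (use assms in \<open>simp_all add: apply_hold_rest heads_below_rest\<close>)

lemma rest_leaf:
  assumes "q \<in> Q" and "0 < s" and "prog q = Accept \<or> prog q = Reject"
  shows "counted machine x s (rest_config (Main q) h D) (if prog q = Accept then 1 else 0)"
proof -
  have "enabled machine x (rest_config (Main q) h D) = {}"
    using assms by (auto simp: enabled_rest)
  moreover have "state (rest_config (Main q) h D) \<in> accepting machine \<longleftrightarrow> prog q = Accept"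
    by (auto simp: rest_config_def machine_def)
  ultimately show ?thesis
    using leaf [of machine x "rest_config (Main q) h D" s] assms(2) by (simp add: heads_below_rest)
qed

text \<open>The number of accepting paths of the program is that of the machine. The input head is always at
  the first letter of the remaining input \<open>w\<close>. The bound on the number of digits is preserved since
  an increment adds a digit only when it produces a power of two, which is at most \<open>B\<close>.\<close>

lemma simulation:
  assumes "computes prog B q w v k"
    and "q \<in> Q" and "x = u @ w"
    and "\<And>i. i < K \<Longrightarrow> value_of (D i) = v i \<and> 2 ^ length (D i) \<le> 2 * B"
    and "0 < B" and space: "\<And>m. 2 ^ m \<le> 2 * B \<Longrightarrow> Suc m < s"
  shows "counted machine x s (rest_config (Main q) (Suc (length u)) D) k"
  using assms(1-4)
proof (induction arbitrary: D u rule: computes.induct)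
  have s: "1 < s"
    using space [of 0] \<open>0 < B\<close> by simp
  {
    case (computes_Accept q w v)
    then show ?case using rest_leaf [of q s x _ D] s by auto
  next
    case (computes_Reject q w v)
    then show ?case using rest_leaf [of q s x _ D] s by auto
  next
    case (computes_Goto q r w v k)
    show ?case
      by (rule rest_step [where r = r and m = Stay])
        (use computes_Goto closed [of q] s in auto)
  next
    case (computes_Inc q i r v w k)
    then have i: "i < K" and r: "r \<in> Q"
      using counters [of q] closed [of q] by auto
    let ?D = "D(i := incr (D i))"
    have len: "2 ^ length (incr (D i)) \<le> 2 * B"
      using length_incr [of "D i"] computes_Inc.prems(3) [OF i] computes_Inc.hyps(2) by auto
    have "counted machine x s (rest_config (Main r) (Suc (length u)) ?D) k"
      using computes_Inc.prems r len by (intro computes_Inc.IH) auto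
    then have "counted machine x s (op_config (Carry i r) (Suc (length u)) D i (tape (D i)) 1) k"
      using Carry_counted [of i _ x r "[]" "D i" s D k] i r computes_Inc.prems(2) space [OF len]
      by simp
    then show ?case
      by (intro start_op [of i _ x q "Carry i r"]) (use computes_Inc i r s in auto)
  next
    case (computes_Dec q i r v w k)
    then have i: "i < K" and r: "r \<in> Q"
      using counters [of q] closed [of q] by auto
    let ?D = "D(i := decr (D i))"
    have val: "value_of (D i) = v i" and len: "2 ^ length (D i) \<le> 2 * B"
      using computes_Dec.prems(3) [OF i] by auto
    have "counted machine x s (rest_config (Main r) (Suc (length u)) ?D) k"
      using computes_Dec.prems computes_Dec.hyps r val by (intro computes_Dec.IH) auto
    then have "counted machine x s (op_config (Borrow i r) (Suc (length u)) D i (tape (D i)) 1) k"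
      using Borrow_counted [of i _ x r "[]" "D i" s D k] i r val computes_Dec.prems(2)
        computes_Dec.hyps(2) space [OF len] by simp
    then show ?case
      by (intro start_op [of i _ x q "Borrow i r"]) (use computes_Dec i r s in auto)
  next
    case (computes_IfZero q i r r' v w k)
    then have i: "i < K" and r: "r \<in> Q" "r' \<in> Q"
      using counters [of q] closed [of q] by auto
    have val: "value_of (D i) = v i" and len: "2 ^ length (D i) \<le> 2 * B"
      using computes_IfZero.prems(3) [OF i] by auto
    have "counted machine x s
        (rest_config (Main (if v i = 0 then r else r')) (Suc (length u)) D) k"
      using computes_IfZero.prems r by (intro computes_IfZero.IH) auto
    then have "counted machine x s (op_config (Test i r r') (Suc (length u)) D i (tape (D i)) 1) k"
      using Test_counted [of i _ x r r' "[]" "D i" s D k] i r val computes_IfZero.prems(2)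
        space [OF len] by simp
    then show ?case
      by (intro start_op [of i _ x q "Test i r r'"]) (use computes_IfZero i r s in auto)
  next
    case (computes_Choose q r r' w v k l)
    let ?c = "\<lambda>q. rest_config (Main q) (Suc (length u)) D"
    have mem: "Main q \<in> states"
      using computes_Choose by simp
    have "apply_action x (to_nat (Main p), Stay, hold (replicate K 3)) (?c q) = ?c p" for p
      using computes_Choose by (simp add: apply_hold_rest)
    then show ?case
      using computes_Choose closed [of q] s
      by (intro counted_choice [where a = "(to_nat (Main r), Stay, hold (replicate K 3))"
          and b = "(to_nat (Main r'), Stay, hold (replicate K 3))"])
        (auto simp: enabled_rest [OF mem] heads_below_rest)
  next
    case (computes_Read_end q r r' r'' v k)
    show ?case
      by (rule rest_step [where r = r'' and m = Stay])
        (use computes_Read_end closed [of q] s in \<open>auto simp: input_at_def\<close>)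
  next
    case (computes_Read q r r' r'' b v w k)
    let ?r = "if b then r else r'"
    have "counted machine x s (rest_config (Main ?r) (Suc (length (u @ [b]))) D) k"
      using computes_Read closed [of q] by (intro computes_Read.IH) auto
    then show ?case
      by - (rule rest_step [where r = ?r and m = MoveRight],
        use computes_Read s in \<open>auto simp: input_at_def\<close>)
  }
qed

text \<open>The first step writes the marker on every work tape and moves the input head from the left end
  marker to the first letter.\<close>

lemma machine_counted:
  assumes "computes prog B q0 x (\<lambda>_. 0) k" and "0 < B" and "\<And>m. 2 ^ m \<le> 2 * B \<Longrightarrow> Suc m < s"
  shows "counted machine x s (initial_config machine) k"
proof (rule counted_step)
  let ?a = "(to_nat (Main q0), MoveRight, replicate K (3, Stay))"
  show "enabled machine x (initial_config machine) = {?a}"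
    by (subst enabled_machine [where s = Init and gs = "replicate K 2"])
      (auto simp: initial_config_def machine_def map_replicate_const)
  show "heads_below s (initial_config machine)"
    using assms(3) [of 0] assms(2) by (auto simp: heads_below_def initial_config_def)
  have "(\<lambda>_. 2)(0 := 3) = tape []"
    by (auto simp: tape_def)
  then have "apply_action x ?a (initial_config machine) = rest_config (Main q0) 1 (\<lambda>_. [])"
    by (auto simp: apply_action_def initial_config_def rest_config_def at_rest_def machine_def
        list_eq_iff_nth_eq)
  then show "counted machine x s (apply_action x ?a (initial_config machine)) k"
    using simulation [OF assms(1) start_in_Q, of x "[]" "\<lambda>_. []" s] assms(2,3) by simp
qed

text \<open>If the program counts correctly on all inputs and its counters are bounded by the input length
  plus 1, then the machine works in logarithmic space.\<close>

theorem sharp_L_if_computes: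
  assumes "\<And>w. computes prog (Suc (length w)) q0 w (\<lambda>_. 0) (f w)"
  shows "f \<in> sharp_L"
proof -
  define s where "s n = nat \<lceil>log 2 (real (2 * Suc n))\<rceil> + 2" for n
  have "Suc m < s n" if "2 ^ m \<le> 2 * Suc n" for m n
  proof -
    have "real (2 ^ m) \<le> real (2 * Suc n)"
      using that by (subst of_nat_le_iff)
    then have "real m \<le> log 2 (real (2 * Suc n))"
      by (subst le_log_iff) (auto simp: powr_realpow)
    then show ?thesis
      unfolding s_def by linarith
  qed
  then have "counted machine x (s (length x)) (initial_config machine) (f x)" for x
    using machine_counted [OF assms] by simp
  moreover have "(\<lambda>n. real (s n)) \<in> O(\<lambda>n. ln (real n))"
  proof (rule bigoI [where c = "6 / ln 2"])
    show "\<forall>\<^sub>F n in sequentially. norm (real (s n)) \<le> 6 / ln 2 * norm (ln (real n))"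
      using eventually_ge_at_top [of "2::nat"]
    proof eventually_elim
      case (elim n)
      \<comment> \<open>The crude bound \<open>2 (n + 1) \<le> n\<^sup>3\<close> turns the logarithm into a multiple of \<open>ln n\<close>.\<close>
      have "2 * Suc n \<le> 2 * 2 * n"
        using elim by simp
      also have "\<dots> \<le> n * n * n"
        by (intro mult_le_mono elim order.refl)
      finally have "2 * Suc n \<le> n ^ 3"
        by (simp only: power3_eq_cube)
      then have "real (2 * Suc n) \<le> real n ^ 3"
        by (metis of_nat_le_iff of_nat_power)
      then have "log 2 (real (2 * Suc n)) \<le> 3 * log 2 (real n)"
        using elim log_mono [of 2 "real (2 * Suc n)" "real n ^ 3"] by (simp add: log_nat_power)
      moreover have "0 \<le> log 2 (real (2 * Suc n))" "1 \<le> log 2 (real n)"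
        using elim by (auto simp: le_log_iff)
      ultimately have "real (s n) \<le> 6 * log 2 (real n)"
        unfolding s_def by linarith
      then show ?case
        using elim by (simp add: log_def)
    qed
  qed
  ultimately show ?thesis
    using wf_machine by (intro sharp_L_I [of machine s]) auto
qed

end


section \<open>Removing the largest entries of a tableau\<close>

text \<open>Semistandard fillings of a set \<open>Y\<close> of cells with entries at most \<open>M\<close>, the value \<open>M\<close> being
  permitted only in the cells belonging to \<open>A\<close>.\<close>

definition tableaux :: "nat \<Rightarrow> (nat \<times> nat) set \<Rightarrow> (nat \<times> nat) set \<Rightarrow> (nat \<times> nat \<Rightarrow> nat) set" where
  "tableaux M Y A = {T \<in> Y \<rightarrow>\<^sub>E {1..M}.
     (\<forall>i j. (i, j) \<in> Y \<longrightarrow> (i, j + 1) \<in> Y \<longrightarrow> T (i, j) \<le> T (i, j + 1)) \<and>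
     (\<forall>i j. (i, j) \<in> Y \<longrightarrow> (i + 1, j) \<in> Y \<longrightarrow> T (i, j) < T (i + 1, j)) \<and>
     (\<forall>y \<in> Y. T y = M \<longrightarrow> y \<in> A)}"

lemma SSYT_tableaux: "SSYT N l = tableaux N (young_diagram l) UNIV"
  by (simp add: SSYT_def tableaux_def)

lemma finite_tableaux: "finite Y \<Longrightarrow> finite (tableaux M Y A)"
  by (rule finite_subset [of _ "Y \<rightarrow>\<^sub>E {1..M}"]) (auto simp: tableaux_def finite_PiE)

lemma tableaux_region: "tableaux M Y A = {T \<in> tableaux M Y UNIV. \<forall>y \<in> Y. T y = M \<longrightarrow> y \<in> A}"
  by (auto simp: tableaux_def)

lemma tableaux_mono: "A \<subseteq> B \<Longrightarrow> tableaux M Y A \<subseteq> tableaux M Y B"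
  by (auto simp: tableaux_def)

lemma tableaux_not_max: "T \<in> tableaux M Y A \<Longrightarrow> y \<in> Y \<Longrightarrow> y \<notin> A \<Longrightarrow> T y < M"
  by (force simp: tableaux_def PiE_iff)

lemma tableaux_le: "T \<in> tableaux M Y A \<Longrightarrow> y \<in> Y \<Longrightarrow> T y \<le> M"
  by (auto simp: tableaux_def PiE_iff)

lemma tableaux_row: "T \<in> tableaux M Y A \<Longrightarrow> (i, j) \<in> Y \<Longrightarrow> (i, Suc j) \<in> Y \<Longrightarrow> T (i, j) \<le> T (i, Suc j)"
  by (simp add: tableaux_def)

lemma tableaux_column: "T \<in> tableaux M Y A \<Longrightarrow> (i, j) \<in> Y \<Longrightarrow> (Suc i, j) \<in> Y \<Longrightarrow> T (i, j) < T (Suc i, j)"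
  by (simp add: tableaux_def)

lemma tableaux_row_le:
  assumes "j \<le> j'" and "T \<in> tableaux M Y A" and "\<And>k. j \<le> k \<Longrightarrow> k \<le> j' \<Longrightarrow> (i, k) \<in> Y"
  shows "T (i, j) \<le> T (i, j')"
  using assms(1,3)
proof (induction rule: dec_induct)
  case (step n)
  then show ?case
    using tableaux_row [OF assms(2), of i n] by fastforce
qed simp

lemma tableaux_column_less:
  assumes "i < i'" and "T \<in> tableaux M Y A" and "\<And>k. i \<le> k \<Longrightarrow> k \<le> i' \<Longrightarrow> (k, j) \<in> Y"
  shows "T (i, j) < T (i', j)"
  using assms(1,3)
proof (induction rule: strict_inc_induct)
  case (base k)
  then show ?case
    using tableaux_column [OF assms(2), of k j] by simp
next
  case (step k)
  then have "T (Suc k, j) < T (i', j)"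
    by simp
  then show ?case
    using tableaux_column [OF assms(2), of k j] step by fastforce
qed

text \<open>The permitted region may be shrunk if the value \<open>M\<close> is impossible in the cells given up.\<close>

lemma tableaux_shrink:
  assumes "B \<subseteq> A" and "\<And>T y. T \<in> tableaux M Y A \<Longrightarrow> y \<in> Y \<Longrightarrow> y \<in> A - B \<Longrightarrow> T y < M"
  shows "tableaux M Y A = tableaux M Y B"
proof (rule equalityI [OF _ tableaux_mono [OF assms(1)]], rule subsetI)
  fix T
  assume T: "T \<in> tableaux M Y A"
  have "y \<in> B" if "y \<in> Y" "T y = M" for y
    using assms(2) [OF T that(1)] tableaux_not_max [OF T that(1)] that(2) by auto
  then show "T \<in> tableaux M Y B"
    using T tableaux_region [of M Y A] tableaux_region [of M Y B] by blast
qed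

lemma tableaux_cong: "Y \<inter> A = Y \<inter> B \<Longrightarrow> tableaux M Y A = tableaux M Y B"
  by (subst (1 2) tableaux_region) blast

text \<open>If the largest value is permitted nowhere, it may be dropped.\<close>

lemma tableaux_Suc_empty: "tableaux (Suc N) Y {} = tableaux N Y UNIV"
proof -
  have "x \<in> {1..Suc N} \<and> x \<noteq> Suc N \<longleftrightarrow> x \<in> {1..N}" for x
    by auto
  then have "T \<in> Y \<rightarrow>\<^sub>E {1..N} \<longleftrightarrow> T \<in> Y \<rightarrow>\<^sub>E {1..Suc N} \<and> (\<forall>y \<in> Y. T y \<noteq> Suc N)" for T
    unfolding PiE_iff by blast
  then show ?thesis
    by (simp add: tableaux_def conj_ac)
qed

lemma card_tableaux_0: "card (tableaux 0 Y UNIV) = (if Y = {} then 1 else 0)"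
proof (cases "Y = {}")
  case False
  then have "tableaux 0 Y UNIV = {}"
    by (auto simp: tableaux_def PiE_iff)
  then show ?thesis
    using False by simp
qed (simp add: tableaux_def)

text \<open>A corner may contain the value \<open>M\<close> or not. If it does, then no other cell of its column contains
  \<open>M\<close>, as the columns increase strictly. Conversely, any filling of the remaining cells that has no
  \<open>M\<close> in the column of the corner can be extended by \<open>M\<close>.\<close>

lemma card_tableaux_corner:
  assumes "finite Y" and "0 < M" and z: "(i, j) \<in> Y" "(i, j) \<in> A" "(Suc i, j) \<notin> Y" "(i, Suc j) \<notin> Y"
    and column: "\<And>k. (k, j) \<in> Y \<Longrightarrow> k \<le> i \<and> (\<forall>k' \<in> {k..i}. (k', j) \<in> Y)"
  shows "card (tableaux M Y A) =
    card (tableaux M Y (A - {(i, j)})) + card (tableaux M (Y - {(i, j)}) (A - UNIV \<times> {j}))"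
proof -
  let ?z = "(i, j)"
  let ?Y = "Y - {?z}" and ?B = "A - UNIV \<times> {j}"
  let ?P = "{T \<in> tableaux M Y A. T ?z = M}"
  have "T \<in> tableaux M Y (A - {?z}) \<longleftrightarrow> T \<in> tableaux M Y A \<and> T ?z \<noteq> M" for T
    by (subst (1 2) tableaux_region) (use z in blast)
  then have "tableaux M Y A = tableaux M Y (A - {?z}) \<union> ?P" "tableaux M Y (A - {?z}) \<inter> ?P = {}"
    by auto
  then have "card (tableaux M Y A) = card (tableaux M Y (A - {?z})) + card ?P"
    using finite_tableaux [OF assms(1), of M A] card_Un_disjoint [of "tableaux M Y (A - {?z})" ?P]
      finite_tableaux [OF assms(1), of M "A - {?z}"] by simp
  moreover have "bij_betw (\<lambda>T. T(?z := undefined)) ?P (tableaux M ?Y ?B)"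
  proof (rule bij_betw_byWitness [where f' = "\<lambda>T. T(?z := M)"])
    show "\<forall>T \<in> ?P. (T(?z := undefined))(?z := M) = T"
      by auto
    show "\<forall>T \<in> tableaux M ?Y ?B. (T(?z := M))(?z := undefined) = T"
      by (auto simp: tableaux_def PiE_iff extensional_def fun_eq_iff)
    show "(\<lambda>T. T(?z := undefined)) ` ?P \<subseteq> tableaux M ?Y ?B"
    proof (rule image_subsetI)
      fix T
      assume "T \<in> ?P"
      then have T: "T \<in> tableaux M Y A" and max: "T ?z = M"
        by auto
      have less: "T (k, j) < M" if "(k, j) \<in> Y" "k \<noteq> i" for k
        unfolding max [symmetric]
        using that column [of k] by (intro tableaux_column_less [OF _ T]) auto
      have "y \<in> ?B" if "y \<in> ?Y" "T y = M" for y
        using that T less [of "fst y"] by (cases y) (auto simp: tableaux_region [of M Y A])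
      moreover have "T(?z := undefined) \<in> ?Y \<rightarrow>\<^sub>E {1..M}"
        using T by (auto simp: tableaux_def PiE_iff extensional_def)
      ultimately show "T(?z := undefined) \<in> tableaux M ?Y ?B"
        using tableaux_row [OF T] tableaux_column [OF T] by (simp add: tableaux_def)
    qed
    show "(\<lambda>T. T(?z := M)) ` tableaux M ?Y ?B \<subseteq> ?P"
    proof (rule image_subsetI)
      fix T
      assume T: "T \<in> tableaux M ?Y ?B"
      have le: "T y \<le> M" if "y \<in> ?Y" for y
        using tableaux_le [OF T that] .
      have less: "T (k, j) < M" if "(k, j) \<in> ?Y" for k
        by (rule tableaux_not_max [OF T that]) simp
      let ?T = "T(?z := M)"
      have "?T \<in> Y \<rightarrow>\<^sub>E {1..M}"
        using T assms(2) z by (auto simp: tableaux_def PiE_iff extensional_def)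
      moreover have "?T (a, b) \<le> ?T (a, b + 1)" if "(a, b) \<in> Y" "(a, b + 1) \<in> Y" for a b
        using tableaux_row [OF T, of a b] le [of "(a, b)"] that z by auto
      moreover have "?T (a, b) < ?T (a + 1, b)" if "(a, b) \<in> Y" "(a + 1, b) \<in> Y" for a b
        using tableaux_column [OF T, of a b] less [of a] that z by auto
      moreover have "y \<in> A" if "y \<in> Y" "?T y = M" for y
        using T that z by (auto simp: tableaux_def split: if_splits)
      ultimately show "?T \<in> ?P"
        by (simp add: tableaux_def)
    qed
  qed
  then have "card ?P = card (tableaux M ?Y ?B)"
    by (rule bij_betw_same_card)
  ultimately show ?thesis
    by simp
qed

section \<open>Diagrams given by differences\<close>

text \<open>\<open>rows_shape C v\<close> is the Young diagram with \<open>C\<close> rows in which \<open>v i\<close> is the difference of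
  the lengths of the rows \<open>i\<close> and \<open>i + 1\<close>; in \<open>cols_shape C v\<close> the same holds for the
  columns. The value \<open>v 0\<close> plays no role.\<close>

text \<open>The length of row (column) \<open>i\<close> in terms of the differences \<open>v\<close>.\<close>

definition tail_sum :: "nat \<Rightarrow> (nat \<Rightarrow> nat) \<Rightarrow> nat \<Rightarrow> nat" where
  "tail_sum C v i = (\<Sum>m = i..C. v m)"

definition rows_shape :: "nat \<Rightarrow> (nat \<Rightarrow> nat) \<Rightarrow> (nat \<times> nat) set" where
  "rows_shape C v = {(i, j). 1 \<le> i \<and> i \<le> C \<and> 1 \<le> j \<and> j \<le> tail_sum C v i}"

definition cols_shape :: "nat \<Rightarrow> (nat \<Rightarrow> nat) \<Rightarrow> (nat \<times> nat) set" where
  "cols_shape C v = {(i, j). 1 \<le> j \<and> j \<le> C \<and> 1 \<le> i \<and> i \<le> tail_sum C v j}"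

text \<open>Removing the last cell of row (or column) \<open>i\<close> decreases \<open>v i\<close> and increases
  \<open>v (i - 1)\<close>.\<close>

definition shift :: "(nat \<Rightarrow> nat) \<Rightarrow> nat \<Rightarrow> nat \<Rightarrow> nat" where
  "shift v i = v(i := v i - 1, i - 1 := Suc (v (i - 1)))"

lemma tail_sum_Suc: "i \<le> C \<Longrightarrow> tail_sum C v i = v i + tail_sum C v (Suc i)"
  by (simp add: tail_sum_def sum.atLeast_Suc_atMost)

lemma tail_sum_beyond [simp]: "C < i \<Longrightarrow> tail_sum C v i = 0"
  by (simp add: tail_sum_def)

lemma tail_sum_antimono: "i \<le> k \<Longrightarrow> tail_sum C v k \<le> tail_sum C v i"
  unfolding tail_sum_def by (rule sum_mono2) auto

lemma tail_sum_less: "1 \<le> i \<Longrightarrow> i \<le> C \<Longrightarrow> v i > 0 \<Longrightarrow> i < k \<Longrightarrow> tail_sum C v k < tail_sum C v i"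
  using tail_sum_antimono [of "Suc i" k C v] tail_sum_Suc [of i C v] by simp

lemma tail_sum_shift:
  assumes "1 \<le> i" and "i \<le> C" and "v i > 0"
  shows "tail_sum C (shift v i) k = (if k = i then tail_sum C v k - 1 else tail_sum C v k)"
proof -
  have "shift v i m + (if m = i then 1 else 0) = v m + (if m = i - 1 then 1 else 0)" for m
    using assms by (auto simp: shift_def)
  then have "(\<Sum>m = k..C. shift v i m + (if m = i then 1 else 0)) =
      (\<Sum>m = k..C. v m + (if m = i - 1 then 1 else 0))"
    by simp
  then have "tail_sum C (shift v i) k + (if i \<in> {k..C} then 1 else 0) =
      tail_sum C v k + (if i - 1 \<in> {k..C} then 1 else 0)"
    by (simp add: tail_sum_def sum.distrib)
  then show ?thesis
    using assms by (auto split: if_splits)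
qed

lemma finite_rows_shape: "finite (rows_shape C v)"
  by (rule finite_subset [of _ "{..C} \<times> {..tail_sum C v 0}"])
    (auto simp: rows_shape_def intro: order.trans tail_sum_antimono)

lemma finite_cols_shape: "finite (cols_shape C v)"
  by (rule finite_subset [of _ "{..tail_sum C v 0} \<times> {..C}"])
    (auto simp: cols_shape_def intro: order.trans tail_sum_antimono)

lemma rows_shape_shift:
  "1 \<le> i \<Longrightarrow> i \<le> C \<Longrightarrow> v i > 0
    \<Longrightarrow> rows_shape C (shift v i) = rows_shape C v - {(i, tail_sum C v i)}"
  by (auto simp: rows_shape_def tail_sum_shift split: if_splits)

lemma cols_shape_shift:
  "1 \<le> i \<Longrightarrow> i \<le> C \<Longrightarrow> v i > 0
    \<Longrightarrow> cols_shape C (shift v i) = cols_shape C v - {(tail_sum C v i, i)}"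
  by (auto simp: cols_shape_def tail_sum_shift split: if_splits)

lemma rows_shape_empty: "rows_shape C v = {} \<longleftrightarrow> (\<forall>i \<in> {1..C}. v i = 0)"
proof
  assume "\<forall>i \<in> {1..C}. v i = 0"
  then show "rows_shape C v = {}"
    by (auto simp: rows_shape_def tail_sum_def)
next
  assume *: "rows_shape C v = {}"
  show "\<forall>i \<in> {1..C}. v i = 0"
  proof
    fix i
    assume "i \<in> {1..C}"
    with * have "tail_sum C v i < 1"
      by (force simp: rows_shape_def)
    with \<open>i \<in> {1..C}\<close> show "v i = 0"
      by (simp add: tail_sum_Suc)
  qed
qed

lemma cols_shape_empty: "cols_shape C v = {} \<longleftrightarrow> (\<forall>i \<in> {1..C}. v i = 0)"
  unfolding rows_shape_empty [symmetric] by (auto simp: rows_shape_def cols_shape_def)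

text \<open>If rows \<open>i\<close> and \<open>i + 1\<close> have the same length, no cell of row \<open>i\<close> can contain the largest value: the cell
  below would have to be larger.\<close>

lemma rows_sweep_zero:
  assumes "1 \<le> i" and "i \<le> C" and "v i = 0"
  shows "tableaux M (rows_shape C v) {(a, b). i \<le> a} = tableaux M (rows_shape C v) {(a, b). Suc i \<le> a}"
proof (rule tableaux_shrink)
  fix T y
  assume T: "T \<in> tableaux M (rows_shape C v) {(a, b). i \<le> a}" and y: "y \<in> rows_shape C v"
    and "y \<in> {(a, b). i \<le> a} - {(a, b). Suc i \<le> a}"
  then obtain b where b: "y = (i, b)"
    by force
  then have mem: "(Suc i, b) \<in> rows_shape C v"
    using y assms by (cases "i = C") (auto simp: rows_shape_def tail_sum_Suc)
  show "T y < M"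
    using tableaux_column [OF T, of i b] tableaux_le [OF T mem] mem y b by simp
qed auto

text \<open>Otherwise the last cell of row \<open>i\<close> decides. If it does not contain the largest value, then no cell
  of the row does. If it does, the cell can be removed, and row \<open>i\<close> of the smaller diagram may
  contain further copies of the largest value.\<close>

lemma rows_sweep_pos:
  assumes "1 \<le> i" and "i \<le> C" and "v i > 0" and "0 < M"
  shows "card (tableaux M (rows_shape C v) {(a, b). i \<le> a}) =
    card (tableaux M (rows_shape C v) {(a, b). Suc i \<le> a}) +
    card (tableaux M (rows_shape C (shift v i)) {(a, b). i \<le> a})"
    (is "card (tableaux M ?Y ?A) = card (tableaux M ?Y ?B) + card (tableaux M ?Y' ?A)")
proof -
  define t where "t = tail_sum C v i"
  have t: "k > i \<Longrightarrow> tail_sum C v k < t" for k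
    unfolding t_def by (rule tail_sum_less) (use assms in auto)
  have t': "k \<le> i \<Longrightarrow> t \<le> tail_sum C v k" for k
    unfolding t_def by (rule tail_sum_antimono)
  have "0 < t"
    using t [of "Suc i"] by simp
  have up: "k \<le> i" if "(k, t) \<in> ?Y" for k
    using that t [of k] by (force simp: rows_shape_def)
  have "card (tableaux M ?Y ?A) =
      card (tableaux M ?Y (?A - {(i, t)})) + card (tableaux M (?Y - {(i, t)}) (?A - UNIV \<times> {t}))"
  proof (rule card_tableaux_corner)
    show "k \<le> i \<and> (\<forall>k' \<in> {k..i}. (k', t) \<in> ?Y)" if "(k, t) \<in> ?Y" for k
      using up [OF that] that assms t' by (auto simp: rows_shape_def)
  qed (use finite_rows_shape assms \<open>0 < t\<close> t [of "Suc i"] in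
      \<open>auto simp: rows_shape_def t_def [symmetric]\<close>)
  also have "tableaux M ?Y (?A - {(i, t)}) = tableaux M ?Y ?B"
  proof (rule tableaux_shrink)
    fix T y
    assume T: "T \<in> tableaux M ?Y (?A - {(i, t)})" and y: "y \<in> ?Y" and "y \<in> ?A - {(i, t)} - ?B"
    then obtain b where b: "y = (i, b)"
      by force
    have mem: "(i, k) \<in> ?Y" if "b \<le> k" "k \<le> t" for k
      using that y b by (auto simp: rows_shape_def t_def)
    have "b \<le> t"
      using y b by (simp add: rows_shape_def t_def)
    then have "T (i, b) \<le> T (i, t)" and "(i, t) \<in> ?Y"
      using mem by (auto intro: tableaux_row_le [OF _ T])
    then show "T y < M"
      using tableaux_not_max [OF T, of "(i, t)"] b by simp
  qed auto
  also have "?Y - {(i, t)} = ?Y'"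
    using rows_shape_shift [of i C v, OF assms(1-3)] by (simp add: t_def)
  also have "tableaux M ?Y' (?A - UNIV \<times> {t}) = tableaux M ?Y' ?A"
    by (rule tableaux_cong) (use up in \<open>force simp: rows_shape_shift [of i C v, OF assms(1-3)]
        t_def [symmetric]\<close>)
  finally show ?thesis .
qed

text \<open>For columns the largest value is permitted in the first \<open>i\<close> columns. If columns \<open>i\<close> and \<open>i + 1\<close>
  have the same length, then the right neighbour of a cell in column \<open>i\<close> is smaller than the largest
  value, hence so is the cell.\<close>

lemma cols_sweep_zero:
  assumes "1 \<le> i" and "i \<le> C" and "v i = 0"
  shows "tableaux M (cols_shape C v) {(a, b). b \<le> i} = tableaux M (cols_shape C v) {(a, b). b \<le> i - 1}"
proof (rule tableaux_shrink)
  fix T y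
  assume T: "T \<in> tableaux M (cols_shape C v) {(a, b). b \<le> i}" and y: "y \<in> cols_shape C v"
    and "y \<in> {(a, b). b \<le> i} - {(a, b). b \<le> i - 1}"
  then obtain a where a: "y = (a, i)"
    by force
  then have mem: "(a, Suc i) \<in> cols_shape C v"
    using y assms by (cases "i = C") (auto simp: cols_shape_def tail_sum_Suc)
  show "T y < M"
    using tableaux_row [OF T, of a i] tableaux_not_max [OF T mem] mem y a by simp
qed auto

text \<open>Otherwise the last cell of column \<open>i\<close> decides. It is the only cell of the column that can contain
  the largest value, so column \<open>i\<close> is finished after its removal.\<close>

lemma cols_sweep_pos:
  assumes "1 \<le> i" and "i \<le> C" and "v i > 0" and "0 < M"
  shows "card (tableaux M (cols_shape C v) {(a, b). b \<le> i}) =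
    card (tableaux M (cols_shape C v) {(a, b). b \<le> i - 1}) +
    card (tableaux M (cols_shape C (shift v i)) {(a, b). b \<le> i - 1})"
    (is "card (tableaux M ?Y ?A) = card (tableaux M ?Y ?B) + card (tableaux M ?Y' ?B)")
proof -
  define t where "t = tail_sum C v i"
  have t: "k > i \<Longrightarrow> tail_sum C v k < t" for k
    unfolding t_def by (rule tail_sum_less) (use assms in auto)
  have "0 < t"
    using t [of "Suc i"] by simp
  have column: "(k, i) \<in> ?Y \<longleftrightarrow> 1 \<le> k \<and> k \<le> t" for k
    using assms by (auto simp: cols_shape_def t_def)
  have "card (tableaux M ?Y ?A) =
      card (tableaux M ?Y (?A - {(t, i)})) + card (tableaux M (?Y - {(t, i)}) (?A - UNIV \<times> {i}))"
  proof (rule card_tableaux_corner)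
    show "(t, Suc i) \<notin> ?Y"
      using t [of "Suc i"] by (simp add: cols_shape_def)
  qed (use finite_cols_shape assms(4) \<open>0 < t\<close> in \<open>simp_all add: column\<close>)
  also have "tableaux M ?Y (?A - {(t, i)}) = tableaux M ?Y ?B"
  proof (rule tableaux_shrink)
    fix T y
    assume T: "T \<in> tableaux M ?Y (?A - {(t, i)})" and y: "y \<in> ?Y" and "y \<in> ?A - {(t, i)} - ?B"
    then obtain a where a: "y = (a, i)" "a \<noteq> t"
      by force
    then have "1 \<le> a" "a < t"
      using y column by auto
    then have "T (a, i) < T (t, i)"
      by (intro tableaux_column_less [OF _ T]) (simp_all add: column)
    moreover have "(t, i) \<in> ?Y"
      using \<open>0 < t\<close> by (simp add: column)
    ultimately show "T y < M"
      using tableaux_le [OF T, of "(t, i)"] a by simp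
  qed (use assms(1) in auto)
  also have "?Y - {(t, i)} = ?Y'"
    using cols_shape_shift [of i C v, OF assms(1-3)] by (simp add: t_def)
  also have "?A - UNIV \<times> {i} = ?B"
    using assms(1) by auto
  finally show ?thesis .
qed

section \<open>Two counter programs\<close>

text \<open>The counters \<open>1, \<dots>, C\<close> hold the differences that describe the diagram, counter 0 collects
  what is moved out of counter 1, counter \<open>C + 1\<close> holds the number of values still to be removed, and
  counter \<open>C + 2\<close> holds by how much \<open>N\<close> exceeds the number of cells read so far (0 if it does not).

  \<open>ReadN\<close>, \<open>IncN\<close>, \<open>IncMissing\<close> read the block that encodes \<open>N\<close>. In the state \<open>Row\<close> one of the
  following blocks is being read, and the states \<open>RowTest\<close>, \<open>\<dots>\<close>, \<open>MissingDec\<close> update the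
  counters. \<open>Enough\<close> checks that there are at least \<open>N\<close> cells. Then, for each value, one round
  is performed, in which \<open>Sweep i\<close>, \<open>Pick i\<close> decide whether the last cell of row or column \<open>i\<close> is
  removed, and \<open>Take i\<close>, \<open>Give i\<close> remove it. \<open>AllZero\<close> checks that the diagram has become empty.\<close>

datatype label =
  ReadN | IncN | IncMissing
| Row nat nat | RowTest nat | RowDec nat | RowInc nat | LastRow | RowEnd nat | LastRowEnd nat
| Missing nat nat | MissingDec nat nat | Enough
| Round | Tick | Sweep nat | Pick nat | Take nat | Give nat | AllZero nat | Fail

instance label :: countable
  by countable_datatype

text \<open>The instructions that the two programs have in common.\<close>

fun common_prog :: "nat \<Rightarrow> label \<Rightarrow> label instr" where
  "common_prog C IncN = Inc (Suc C) IncMissing"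
| "common_prog C IncMissing = Inc (Suc (Suc C)) ReadN"
| "common_prog C (Missing i b) = IfZero (Suc (Suc C)) (Row i b) (MissingDec i b)"
| "common_prog C (MissingDec i b) = Dec (Suc (Suc C)) (Row i b)"
| "common_prog C Enough = IfZero (Suc (Suc C)) Round Fail"
| "common_prog C Round = IfZero (Suc C) (AllZero C) Tick"
| "common_prog C (AllZero i) = (if i = 0 then Accept else IfZero i (AllZero (i - 1)) Fail)"
| "common_prog C (Take i) = Dec i (Give i)"
| "common_prog C _ = Reject"

text \<open>The program for \<open>C\<close> rows. In \<open>Row i b\<close> the number of the row being read is \<open>i\<close>, and \<open>b\<close> is always
  0. While row \<open>i\<close> is read, counter \<open>i - 1\<close> holds the difference between the length of row \<open>i - 1\<close> and
  the part read so far; the input is rejected if it would become negative. A sweep runs upwards and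
  may remove any number of cells from a row.\<close>

fun row_prog :: "nat \<Rightarrow> label \<Rightarrow> label instr" where
  "row_prog C ReadN = Read IncN (if C = 0 then Fail else Row 1 0) (if C = 0 then Enough else Fail)"
| "row_prog C (Row i b) = Read (if i = 1 then RowInc 1 else RowTest i)
     (if i < C then Row (Suc i) 0 else Fail) (if i = C then LastRow else Fail)"
| "row_prog C (RowTest i) = IfZero (i - 1) Fail (RowDec i)"
| "row_prog C (RowDec i) = Dec (i - 1) (RowInc i)"
| "row_prog C (RowInc i) = Inc i (Missing i 0)"
| "row_prog C LastRow = IfZero C Fail Enough"
| "row_prog C Tick = Dec (Suc C) (Sweep 1)"
| "row_prog C (Sweep i) = (if i \<le> C then IfZero i (Sweep (Suc i)) (Pick i) else Goto Round)"
| "row_prog C (Pick i) = Choose (Sweep (Suc i)) (Take i)"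
| "row_prog C (Give i) = Inc (i - 1) (Sweep i)"
| "row_prog C q = common_prog C q"

text \<open>The program for rows of length at most \<open>C\<close>. In \<open>Row j b\<close> there are \<open>j\<close> cells of the current row
  read, and \<open>b\<close> bounds its length: it is the length of the previous row, or \<open>C\<close> for the first row.
  The difference of the lengths of the columns \<open>j\<close> and \<open>j + 1\<close> is the number of rows of length
  \<open>j\<close>, so counter \<open>j\<close> is incremented at the end of the row. A sweep runs downwards and removes at most
  one cell from each column.\<close>

fun col_prog :: "nat \<Rightarrow> label \<Rightarrow> label instr" where
  "col_prog C ReadN = Read IncN (Row 0 C) Enough"
| "col_prog C (Row j b) = Read (if j < b then Missing (Suc j) b else Fail)
     (if j = 0 then Fail else RowEnd j) (if j = 0 then Fail else LastRowEnd j)"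
| "col_prog C (RowEnd j) = Inc j (Row 0 j)"
| "col_prog C (LastRowEnd j) = Inc j Enough"
| "col_prog C Tick = Dec (Suc C) (Sweep C)"
| "col_prog C (Sweep i) = (if i = 0 then Goto Round else Choose (Sweep (i - 1)) (Pick i))"
| "col_prog C (Pick i) = IfZero i Fail (Take i)"
| "col_prog C (Give i) = Inc (i - 1) (Sweep (i - 1))"
| "col_prog C q = common_prog C q"

text \<open>A finite set of labels that contains all those reached; \<open>Sweep i\<close> occurs for \<open>i \<le> m\<close>.\<close>

definition labels :: "nat \<Rightarrow> nat \<Rightarrow> label set" where
  "labels m C = {ReadN, IncN, IncMissing, LastRow, Enough, Round, Tick, Fail} \<union> Sweep ` {..m} \<union>
     (\<Union>i \<in> {..C}. {RowTest i, RowDec i, RowInc i, RowEnd i, LastRowEnd i, Pick i, Take i, Give i, AllZero i} \<union>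
       (\<Union>b \<in> {..C}. {Row i b, Missing i b, MissingDec i b}))"

lemma counter_machine_row_prog: "counter_machine (row_prog C) (labels (Suc C) C) (C + 3) ReadN"
proof
  show "set_instr (row_prog C q) \<subseteq> labels (Suc C) C" if "q \<in> labels (Suc C) C" for q
    using that unfolding labels_def by (cases "(C, q)" rule: row_prog.cases) (auto split: if_splits)
  show "counters_of (row_prog C q) \<subseteq> {..<C + 3}" if "q \<in> labels (Suc C) C" for q
    using that unfolding labels_def by (cases "(C, q)" rule: row_prog.cases) (auto split: if_splits)
qed (auto simp: labels_def)

lemma counter_machine_col_prog: "counter_machine (col_prog C) (labels C C) (C + 3) ReadN"
proof
  show "set_instr (col_prog C q) \<subseteq> labels C C" if "q \<in> labels C C" for q
    using that unfolding labels_def by (cases "(C, q)" rule: col_prog.cases) (auto split: if_splits)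
  show "counters_of (col_prog C q) \<subseteq> {..<C + 3}" if "q \<in> labels C C" for q
    using that unfolding labels_def by (cases "(C, q)" rule: col_prog.cases) (auto split: if_splits)
qed (auto simp: labels_def)

section \<open>One round for every value\<close>

lemma tail_sum_upd [simp]: "C < i \<Longrightarrow> tail_sum C (v(i := a)) = tail_sum C v"
  by (auto simp: tail_sum_def fun_eq_iff intro!: sum.cong)

lemma rows_shape_upd [simp]: "C < i \<Longrightarrow> rows_shape C (v(i := a)) = rows_shape C v"
  by (simp add: rows_shape_def)

lemma cols_shape_upd [simp]: "C < i \<Longrightarrow> cols_shape C (v(i := a)) = cols_shape C v"
  by (simp add: cols_shape_def)

lemma shift_beyond [simp]: "i \<le> C \<Longrightarrow> shift v i (Suc C) = v (Suc C)"
  by (auto simp: shift_def)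

lemma shift_same [simp]: "1 \<le> i \<Longrightarrow> shift v i i = v i - 1"
  by (auto simp: shift_def)

text \<open>During the rounds the sum of the counters \<open>0, \<dots>, C\<close> never changes; it bounds the counter that
  is to be incremented.\<close>

lemma tail_sum_0_bound:
  assumes "1 \<le> i" and "i \<le> C" and "v i > 0"
  shows "v (i - 1) < tail_sum C v 0"
  using tail_sum_Suc [of "i - 1" C v] tail_sum_Suc [of i C v] tail_sum_antimono [of 0 "i - 1" C v]
    assms by simp

lemma computes_AllZero:
  assumes "prog = row_prog C \<or> prog = col_prog C"
  shows "computes prog B (AllZero i) w v (if \<forall>m \<in> {1..i}. v m = 0 then 1 else 0)"
proof (induction i)
  case 0
  show ?case
    using assms computes_Accept [of prog "AllZero 0"] by auto
next
  case (Suc i)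
  have Fail: "computes prog B Fail w v 0"
    using assms by (intro computes_Reject) auto
  have "computes prog B (if v (Suc i) = 0 then AllZero i else Fail) w v
      (if \<forall>m \<in> {1..Suc i}. v m = 0 then 1 else 0)"
    using Suc Fail by (auto simp: atLeastAtMostSuc_conv split: if_splits)
  then show ?case
    using assms by - (rule computes_IfZero, auto)
qed

text \<open>At \<open>Sweep i\<close> it remains to remove those copies of the largest value that lie in the rows from \<open>i\<close>
  on. The last premise is the induction hypothesis for the later rounds.\<close>

lemma computes_row_sweep:
  assumes "1 \<le> i" and "i \<le> Suc C" and "v (Suc C) = N" and "tail_sum C v 0 \<le> B"
    and "\<And>v. v (Suc C) = N \<Longrightarrow> tail_sum C v 0 \<le> B
      \<Longrightarrow> computes (row_prog C) B Round w v (card (tableaux N (rows_shape C v) UNIV))"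
  shows "computes (row_prog C) B (Sweep i) w v
    (card (tableaux (Suc N) (rows_shape C v) {(a, b). i \<le> a}))"
  using assms(2,1,3,4)
proof (induction i arbitrary: v rule: inc_induct)
  case base
  have "tableaux (Suc N) (rows_shape C v) {(a, b). Suc C \<le> a} = tableaux (Suc N) (rows_shape C v) {}"
    by (rule tableaux_cong) (auto simp: rows_shape_def)
  then show ?case
    using assms(5) [of v] base by - (rule computes_Goto, auto simp: tableaux_Suc_empty)
next
  case (step i)
  then have i: "1 \<le> i" "i \<le> C"
    by auto
  show ?case
    using step.prems
  proof (induction "v i" arbitrary: v)
    case 0
    have "computes (row_prog C) B (Sweep (Suc i)) w v
        (card (tableaux (Suc N) (rows_shape C v) {(a, b). Suc i \<le> a}))"
      using 0 by (intro step.IH) auto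
    then show ?case
      using 0 i rows_sweep_zero [of i C v] by - (rule computes_IfZero, auto)
  next
    case (Suc n)
    let ?k = "\<lambda>v i. card (tableaux (Suc N) (rows_shape C v) {(a, b). i \<le> a})"
    have pos: "v i > 0"
      using Suc by simp
    have "computes (row_prog C) B (Sweep i) w (shift v i) (?k (shift v i) i)"
      using Suc(2-) i pos by (intro Suc(1)) (auto simp: tail_sum_shift)
    then have "computes (row_prog C) B (Give i) w (v(i := v i - 1)) (?k (shift v i) i)"
      using tail_sum_0_bound [of i C v] i pos Suc.prems
      by - (rule computes_Inc [where i = "i - 1" and r = "Sweep i"], auto simp: shift_def)
    then have "computes (row_prog C) B (Take i) w v (?k (shift v i) i)"
      using pos by - (rule computes_Dec [where i = i and r = "Give i"], auto)
    moreover have "computes (row_prog C) B (Sweep (Suc i)) w v (?k v (Suc i))"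
      using Suc by (intro step.IH) auto
    ultimately have "computes (row_prog C) B (Pick i) w v (?k v (Suc i) + ?k (shift v i) i)"
      by - (rule computes_Choose, auto)
    then show ?case
      unfolding rows_sweep_pos [of i C v "Suc N", OF i pos zero_less_Suc]
      using i pos by - (rule computes_IfZero, auto)
  qed
qed

lemma computes_row_rounds:
  assumes "tail_sum C v 0 \<le> B"
  shows "computes (row_prog C) B Round w v (card (tableaux (v (Suc C)) (rows_shape C v) UNIV))"
  using assms
proof (induction "v (Suc C)" arbitrary: v)
  case 0
  have "computes (row_prog C) B (AllZero C) w v (card (tableaux (v (Suc C)) (rows_shape C v) UNIV))"
    using computes_AllZero [of "row_prog C" C B C w v] 0
    by (simp add: card_tableaux_0 rows_shape_empty)
  then show ?case
    using 0 by - (rule computes_IfZero, auto)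
next
  case (Suc N)
  let ?v = "v(Suc C := v (Suc C) - 1)"
  have "computes (row_prog C) B (Sweep 1) w ?v
      (card (tableaux (Suc N) (rows_shape C ?v) {(a, b). 1 \<le> a}))"
    using Suc by (intro computes_row_sweep) (auto simp: Suc(2) [symmetric])
  also have "tableaux (Suc N) (rows_shape C ?v) {(a, b). 1 \<le> a} =
      tableaux (Suc N) (rows_shape C v) UNIV"
    by (simp, rule tableaux_cong) (auto simp: rows_shape_def)
  finally have "computes (row_prog C) B Tick w v (card (tableaux (v (Suc C)) (rows_shape C v) UNIV))"
    using Suc(2) by - (rule computes_Dec, auto simp: fun_upd_def)
  then show ?case
    using Suc(2) by - (rule computes_IfZero, auto)
qed

text \<open>At \<open>Sweep i\<close> it remains to remove those copies of the largest value that lie in the first \<open>i\<close>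
  columns.\<close>

lemma computes_col_sweep:
  assumes "i \<le> C" and "v (Suc C) = N" and "tail_sum C v 0 \<le> B"
    and "\<And>v. v (Suc C) = N \<Longrightarrow> tail_sum C v 0 \<le> B
      \<Longrightarrow> computes (col_prog C) B Round w v (card (tableaux N (cols_shape C v) UNIV))"
  shows "computes (col_prog C) B (Sweep i) w v
    (card (tableaux (Suc N) (cols_shape C v) {(a, b). b \<le> i}))"
  using assms(1-3)
proof (induction i arbitrary: v)
  case 0
  have "tableaux (Suc N) (cols_shape C v) {(a, b). b \<le> 0} = tableaux (Suc N) (cols_shape C v) {}"
    by (rule tableaux_cong) (auto simp: cols_shape_def)
  then show ?case
    using assms(4) [of v] 0 by - (rule computes_Goto, auto simp: tableaux_Suc_empty)
next
  case (Suc i)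
  let ?i = "Suc i"
  let ?k = "\<lambda>v i. card (tableaux (Suc N) (cols_shape C v) {(a, b). b \<le> i})"
  have skip: "computes (col_prog C) B (Sweep i) w v (?k v i)"
    using Suc by (intro Suc.IH) auto
  show ?case
  proof (cases "v ?i = 0")
    case True
    have "computes (col_prog C) B Fail w v 0"
      by (rule computes_Reject) simp
    with True have "computes (col_prog C) B (Pick ?i) w v 0"
      by - (rule computes_IfZero, auto)
    with skip have "computes (col_prog C) B (Sweep ?i) w v (?k v i + 0)"
      by - (rule computes_Choose, auto)
    then show ?thesis
      using cols_sweep_zero [of ?i C v] True Suc.prems by simp
  next
    case False
    have "computes (col_prog C) B (Sweep i) w (shift v ?i) (?k (shift v ?i) i)"
      using Suc.prems False by (intro Suc.IH) (auto simp: tail_sum_shift)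
    then have "computes (col_prog C) B (Give ?i) w (v(?i := v ?i - 1)) (?k (shift v ?i) i)"
      using tail_sum_0_bound [of ?i C v] False Suc.prems
      by - (rule computes_Inc [where i = "?i - 1" and r = "Sweep i"], auto simp: shift_def)
    then have "computes (col_prog C) B (Take ?i) w v (?k (shift v ?i) i)"
      using False by - (rule computes_Dec [where i = ?i and r = "Give ?i"], auto)
    then have "computes (col_prog C) B (Pick ?i) w v (?k (shift v ?i) i)"
      using False by - (rule computes_IfZero, auto)
    with skip have "computes (col_prog C) B (Sweep ?i) w v (?k v i + ?k (shift v ?i) i)"
      by - (rule computes_Choose, auto)
    then show ?thesis
      using cols_sweep_pos [of ?i C v "Suc N"] False Suc.prems by simp
  qed
qed

lemma computes_col_rounds:
  assumes "tail_sum C v 0 \<le> B"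
  shows "computes (col_prog C) B Round w v (card (tableaux (v (Suc C)) (cols_shape C v) UNIV))"
  using assms
proof (induction "v (Suc C)" arbitrary: v)
  case 0
  have "computes (col_prog C) B (AllZero C) w v (card (tableaux (v (Suc C)) (cols_shape C v) UNIV))"
    using computes_AllZero [of "col_prog C" C B C w v] 0
    by (simp add: card_tableaux_0 cols_shape_empty)
  then show ?case
    using 0 by - (rule computes_IfZero, auto)
next
  case (Suc N)
  let ?v = "v(Suc C := v (Suc C) - 1)"
  have "computes (col_prog C) B (Sweep C) w ?v
      (card (tableaux (Suc N) (cols_shape C ?v) {(a, b). b \<le> C}))"
    using Suc by (intro computes_col_sweep) (auto simp: Suc(2) [symmetric])
  also have "tableaux (Suc N) (cols_shape C ?v) {(a, b). b \<le> C} =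
      tableaux (Suc N) (cols_shape C v) UNIV"
    by (simp, rule tableaux_cong) (auto simp: cols_shape_def)
  finally have "computes (col_prog C) B Tick w v (card (tableaux (v (Suc C)) (cols_shape C v) UNIV))"
    using Suc(2) by - (rule computes_Dec, auto simp: fun_upd_def)
  then show ?case
    using Suc(2) by - (rule computes_IfZero, auto)
qed

section \<open>Reading the input\<close>

text \<open>The encoding of the parts; it begins with 0 unless there are none.\<close>

definition blocks :: "nat list \<Rightarrow> bool list" where
  "blocks l = concat (map (\<lambda>p. False # replicate p True) l)"

lemma blocks_simps [simp]: "blocks [] = []" "blocks (p # l) = False # replicate p True @ blocks l"
  by (simp_all add: blocks_def)

lemma encode_blocks: "encode (N, l) = replicate N True @ blocks l"
  by (simp add: encode_def blocks_def)

text \<open>Every string encodes some pair, so an input can only be inadmissible by encoding a pair that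
  violates the conditions on it.\<close>

lemma ex_encode: "\<exists>N l. w = encode (N, l)"
proof (induction w)
  case Nil
  have "[] = encode (0, [])"
    by (simp add: encode_blocks)
  then show ?case by blast
next
  case (Cons b w)
  then obtain N l where "w = encode (N, l)"
    by blast
  then have "b # w = (if b then encode (Suc N, l) else encode (0, N # l))"
    by (simp add: encode_blocks)
  then show ?case by (cases b) auto
qed

lemma zero_extension_encode_if:
  "zero_extension encode D g (encode a) = (if a \<in> D then g a else 0)"
  using zero_extension_encode [OF inj_on_subset [OF inj_encode subset_UNIV], of a D g]
    zero_extension_outside [of "encode a" encode D g] inj_encode
  by (auto simp: inj_image_mem_iff)

lemma sum_list_le_length_encode: "N + sum_list l \<le> length (encode (N, l))"
  by (induction l arbitrary: N) (simp_all add: encode_blocks)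

text \<open>The counter values after \<open>N\<close> letters 1 of the first block have been read.\<close>

definition number_state :: "nat \<Rightarrow> nat \<Rightarrow> nat \<Rightarrow> nat" where
  "number_state C N = (\<lambda>_. 0)(Suc C := N, Suc (Suc C) := N)"

lemma computes_ReadN:
  assumes "prog = row_prog C \<or> prog = col_prog C" and "N + m \<le> B"
    and "computes prog B ReadN w (number_state C (N + m)) k"
  shows "computes prog B ReadN (replicate m True @ w) (number_state C N) k"
  using assms(2,3)
proof (induction m arbitrary: N)
  case (Suc m)
  have "computes prog B ReadN (replicate m True @ w) (number_state C (Suc N)) k"
    using Suc by (intro Suc.IH) auto
  then have "computes prog B IncMissing (replicate m True @ w)
      ((number_state C N)(Suc C := Suc N)) k"
    using assms(1) Suc.prems(1)
    by - (rule computes_Inc [where i = "Suc (Suc C)" and r = ReadN],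
      auto simp: number_state_def fun_upd_twist)
  then have "computes prog B IncN (replicate m True @ w) (number_state C N) k"
    using assms(1) Suc.prems(1)
    by - (rule computes_Inc [where i = "Suc C" and r = IncMissing], auto simp: number_state_def)
  then have "computes prog B ReadN (True # replicate m True @ w) (number_state C N) k"
    using assms(1) by - (erule disjE; rule computes_Read, auto)
  then show ?case by simp
qed simp

lemma computes_Missing:
  assumes "prog = row_prog C \<or> prog = col_prog C"
    and "computes prog B (Row i b) w (v(Suc (Suc C) := v (Suc (Suc C)) - 1)) k"
  shows "computes prog B (Missing i b) w v k"
proof (cases "v (Suc (Suc C)) = 0")
  case True
  then have "v(Suc (Suc C) := v (Suc (Suc C)) - 1) = v"
    by auto
  then show ?thesis
    using assms True by - (rule computes_IfZero [where i = "Suc (Suc C)"], auto)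
next
  case False
  then have "computes prog B (MissingDec i b) w v k"
    using assms by - (rule computes_Dec [where i = "Suc (Suc C)"], auto)
  then show ?thesis
    using assms False by - (rule computes_IfZero [where i = "Suc (Suc C)"], auto)
qed

lemma computes_Fail: "prog = row_prog C \<or> prog = col_prog C \<Longrightarrow> computes prog B Fail w v 0"
  by (rule computes_Reject) auto

lemma computes_Enough:
  assumes "prog = row_prog C \<or> prog = col_prog C"
    and "computes prog B Round w v k"
  shows "computes prog B Enough w v (if v (Suc (Suc C)) = 0 then k else 0)"
  using assms computes_Fail [OF assms(1), of B w v]
  by - (rule computes_IfZero [where i = "Suc (Suc C)" and r = Round and r' = Fail], auto)


subsection \<open>A bounded number of rows\<close>

text \<open>The length of row \<open>m\<close>, counting from 1; it is 0 for rows beyond the last one.\<close>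

definition row_length :: "nat list \<Rightarrow> nat \<Rightarrow> nat" where
  "row_length l m = (if 1 \<le> m \<and> m \<le> length l then l ! (m - 1) else 0)"

text \<open>The counter values when the rows \<open>l\<close> have been read; the last of them may still be incomplete.\<close>

definition row_state :: "nat \<Rightarrow> nat \<Rightarrow> nat list \<Rightarrow> nat \<Rightarrow> nat" where
  "row_state C N l m = (if 1 \<le> m \<and> m \<le> C then row_length l m - row_length l (Suc m)
     else if m = Suc C then N else if m = Suc (Suc C) then N - sum_list l else 0)"

lemma row_length_snoc: "row_length (rs @ [r]) m = (if m = Suc (length rs) then r else row_length rs m)"
  by (auto simp: row_length_def nth_append)

lemma row_length_single: "row_length [r] m = (if m = 1 then r else 0)"
  by (auto simp: row_length_def)

lemma row_length_beyond [simp]: "length rs < m \<Longrightarrow> row_length rs m = 0"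
  by (simp add: row_length_def)

lemma row_length_antimono: "sorted_wrt (\<ge>) l \<Longrightarrow> 1 \<le> i \<Longrightarrow> row_length l (Suc i) \<le> row_length l i"
  using sorted_wrt_nth_less [of "(\<ge>)" l "i - 1" i] by (auto simp: row_length_def)

lemma row_length_le_sum_list: "row_length l m \<le> sum_list l"
  by (auto simp: row_length_def intro: member_le_sum_list)

lemma tail_sum_row_state:
  assumes "sorted_wrt (\<ge>) l" and "length l \<le> C" and "1 \<le> i"
  shows "tail_sum C (row_state C N l) i = row_length l i"
proof (cases "i \<le> Suc C")
  case True
  then show ?thesis
    using assms(3)
  proof (induction i rule: inc_induct)
    case base
    then show ?case using assms(2) by simp
  next
    case (step n)
    then show ?case
      using row_length_antimono [OF assms(1), of n] by (simp add: tail_sum_Suc row_state_def)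
  qed
qed (use assms in simp)

lemma rows_shape_row_state:
  assumes "sorted_wrt (\<ge>) l" and "length l = C"
  shows "rows_shape C (row_state C N l) = young_diagram l"
  using assms by (auto simp: rows_shape_def young_diagram_def tail_sum_row_state row_length_def)

lemma computes_row_Enough:
  assumes "sorted_wrt (\<ge>) l" and "length l = C" and "sum_list l \<le> B"
  shows "computes (row_prog C) B Enough w (row_state C N l)
    (if N \<le> sum_list l then card (SSYT N l) else 0)"
proof -
  have "tail_sum C (row_state C N l) 0 = row_length l 1"
    using tail_sum_row_state [of l C 1 N] assms by (simp add: tail_sum_Suc row_state_def)
  then have "tail_sum C (row_state C N l) 0 \<le> B"
    using row_length_le_sum_list [of l 1] assms(3) by simp
  moreover have "row_state C N l (Suc C) = N" "row_state C N l (Suc (Suc C)) = N - sum_list l"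
    by (simp_all add: row_state_def)
  ultimately show ?thesis
    using computes_Enough [of "row_prog C" C, OF _ computes_row_rounds, of "row_state C N l" B w]
    by (cases "N \<le> sum_list l") (simp_all add: rows_shape_row_state [OF assms(1,2)] SSYT_tableaux)
qed

text \<open>Reading one more cell of the row following \<open>rs\<close>.\<close>

lemma computes_row_True:
  assumes "sorted_wrt (\<ge>) (rs @ [r])" and "Suc (length rs) \<le> C" and "r < B"
    and sorted: "sorted_wrt (\<ge>) (rs @ [Suc r])
      \<Longrightarrow> computes (row_prog C) B (Row (Suc (length rs)) 0) w (row_state C N (rs @ [Suc r])) k"
    and unsorted: "\<not> sorted_wrt (\<ge>) (rs @ [Suc r]) \<Longrightarrow> k = 0"
  shows "computes (row_prog C) B (Row (Suc (length rs)) 0) (True # w) (row_state C N (rs @ [r])) k"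
proof -
  let ?n = "length rs"
  let ?v = "row_state C N (rs @ [r])"
  let ?v1 = "?v(?n := row_length rs ?n - Suc r)"
  have state: "row_state C N (rs @ [Suc r]) =
      (if rs = [] then ?v else ?v1)(Suc ?n := Suc r, Suc (Suc C) := ?v (Suc (Suc C)) - 1)"
    using assms(2)
    by (auto simp: fun_eq_iff row_state_def row_length_snoc row_length_single Suc_le_eq)
  show ?thesis
  proof (cases "sorted_wrt (\<ge>) (rs @ [Suc r])")
    case True
    have "computes (row_prog C) B (Missing (Suc ?n) 0) w
        ((if rs = [] then ?v else ?v1)(Suc ?n := Suc r)) k"
      using sorted [OF True] assms(2) unfolding state by (intro computes_Missing) auto
    then have Inc: "computes (row_prog C) B (RowInc (Suc ?n)) w (if rs = [] then ?v else ?v1) k"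
      using assms(2,3)
      by - (rule computes_Inc [where i = "Suc ?n" and r = "Missing (Suc ?n) 0"],
        auto simp: row_state_def row_length_snoc row_length_single)
    show ?thesis
    proof (cases "rs = []")
      case True
      then show ?thesis
        using Inc by - (rule computes_Read, auto)
    next
      case False
      then have "row_length rs ?n \<in> set rs"
        by (simp add: row_length_def Suc_le_eq)
      then have gt: "r < row_length rs ?n"
        using True by (auto simp: sorted_wrt_append)
      have v: "?v ?n = row_length rs ?n - r"
        using False assms(2) by (auto simp: row_state_def row_length_snoc Suc_le_eq)
      have "computes (row_prog C) B (RowDec (Suc ?n)) w ?v k"
        using Inc False gt v by - (rule computes_Dec [where i = ?n and r = "RowInc (Suc ?n)"], auto)
      then have "computes (row_prog C) B (RowTest (Suc ?n)) w ?v k"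
        using gt v by - (rule computes_IfZero [where i = ?n], auto)
      then show ?thesis
        using False by - (rule computes_Read, auto)
    qed
  next
    case False
    then obtain rs' q where rs: "rs = rs' @ [q]"
      by (cases rs rule: rev_cases) auto
    then have "q \<le> r"
      using False assms(1) by (force simp: sorted_wrt_append)
    moreover have "row_length rs ?n = q" "0 < ?n"
      using rs by (simp_all add: row_length_snoc)
    ultimately have "?v ?n = 0"
      using assms(2) by (simp add: row_state_def row_length_snoc)
    then have "computes (row_prog C) B (RowTest (Suc ?n)) w ?v 0"
      using computes_Fail [of "row_prog C" C B w ?v] by - (rule computes_IfZero [where i = ?n], auto)
    then show ?thesis
      using unsorted [OF False] rs by - (rule computes_Read, auto)
  qed
qed

lemma computes_row_ones:
  assumes "sorted_wrt (\<ge>) (rs @ [r])" and "Suc (length rs) \<le> C" and "r + a \<le> B"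
    and "sorted_wrt (\<ge>) (rs @ [r + a])
      \<Longrightarrow> computes (row_prog C) B (Row (Suc (length rs)) 0) w (row_state C N (rs @ [r + a])) k"
    and "\<not> sorted_wrt (\<ge>) (rs @ [r + a]) \<Longrightarrow> k = 0"
  shows "computes (row_prog C) B (Row (Suc (length rs)) 0) (replicate a True @ w)
    (row_state C N (rs @ [r])) k"
  using assms(1,3-)
proof (induction a arbitrary: r)
  case (Suc a)
  have "computes (row_prog C) B (Row (Suc (length rs)) 0) (True # (replicate a True @ w))
      (row_state C N (rs @ [r])) k"
  proof (rule computes_row_True [OF Suc.prems(1) assms(2)])
    show "r < B"
      using Suc.prems(2) by simp
    show "k = 0" if "\<not> sorted_wrt (\<ge>) (rs @ [Suc r])"
      using that Suc.prems(1,4) by (fastforce simp: sorted_wrt_append)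
    show "computes (row_prog C) B (Row (Suc (length rs)) 0) (replicate a True @ w)
        (row_state C N (rs @ [Suc r])) k" if "sorted_wrt (\<ge>) (rs @ [Suc r])"
      using that Suc.prems(2-) by (intro Suc.IH) auto
  qed
  then show ?case by simp
qed simp

text \<open>The expected number of accepting paths on the encoding of \<open>(N, l)\<close>.\<close>

definition row_value :: "nat \<Rightarrow> nat \<Rightarrow> nat list \<Rightarrow> nat" where
  "row_value C N l =
     (if is_partition l \<and> length l = C \<and> N \<le> sum_list l then card (SSYT N l) else 0)"

lemma computes_row_parse:
  assumes "sorted_wrt (\<ge>) (rs @ [r])" and "Suc (length rs) \<le> C"
    and "sum_list (rs @ (r + a) # l) \<le> B"
  shows "computes (row_prog C) B (Row (Suc (length rs)) 0) (replicate a True @ blocks l)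
    (row_state C N (rs @ [r])) (row_value C N (rs @ (r + a) # l))"
  using assms
proof (induction l arbitrary: rs r a)
  case Nil
  let ?l = "rs @ [r + a]"
  let ?v = "row_state C N ?l"
  show ?case
  proof (rule computes_row_ones)
    assume sorted: "sorted_wrt (\<ge>) ?l"
    show "computes (row_prog C) B (Row (Suc (length rs)) 0) (blocks []) ?v (row_value C N ?l)"
    proof (cases "length ?l = C")
      case True
      have part: "is_partition ?l \<longleftrightarrow> r + a \<noteq> 0"
        using sorted by (force simp: is_partition_def sorted_wrt_append)
      have v: "?v C = r + a"
        using True by (auto simp: row_state_def row_length_snoc)
      have "computes (row_prog C) B (if ?v C = 0 then Fail else Enough) [] ?v (row_value C N ?l)"
        using computes_row_Enough [OF sorted True, of B "[]" N] Nil.prems(3) True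
          computes_Fail [of "row_prog C" C B "[]" ?v]
        unfolding v row_value_def part by auto
      then have "computes (row_prog C) B LastRow [] ?v (row_value C N ?l)"
        by - (rule computes_IfZero [where i = C], auto)
      then show ?thesis
        using True by - (simp, rule computes_Read_end, auto)
    next
      case False
      then show ?thesis
        using computes_Fail [of "row_prog C" C B "[]" ?v]
        by - (simp, rule computes_Read_end, auto simp: row_value_def)
    qed
  qed (use Nil in \<open>auto simp: row_value_def is_partition_def\<close>)
next
  case (Cons p l)
  let ?l = "rs @ [r + a]"
  let ?v = "row_state C N ?l"
  let ?k = "row_value C N (rs @ (r + a) # p # l)"
  show ?case
  proof (rule computes_row_ones)
    assume sorted: "sorted_wrt (\<ge>) ?l"
    have "computes (row_prog C) B (if Suc (length rs) < C then Row (Suc (Suc (length rs))) 0 else Fail)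
        (replicate p True @ blocks l) ?v ?k"
    proof (cases "Suc (length rs) < C")
      case True
      have "?v = row_state C N (?l @ [0])"
        by (simp add: row_state_def row_length_snoc fun_eq_iff del: append_assoc)
      then show ?thesis
        using Cons.IH [of ?l 0 p] True sorted Cons.prems by (simp add: sorted_wrt_append)
    next
      case False
      then show ?thesis
        using computes_Fail [of "row_prog C" C] by (auto simp: row_value_def)
    qed
    then show "computes (row_prog C) B (Row (Suc (length rs)) 0) (blocks (p # l)) ?v ?k"
      by - (simp, rule computes_Read, auto)
  qed (use Cons in \<open>auto simp: row_value_def is_partition_def sorted_wrt_append\<close>)
qed

theorem row_count_in_sharp_L:
  "zero_extension encode {(N, l). is_partition l \<and> length l = C \<and> N \<le> sum_list l}
     (\<lambda>(N, l). card (SSYT N l)) \<in> sharp_L"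
    (is "?f \<in> sharp_L")
proof (rule counter_machine.sharp_L_if_computes [OF counter_machine_row_prog])
  fix w
  obtain N l where w: "w = encode (N, l)"
    using ex_encode by blast
  let ?B = "Suc (length w)"
  have bound: "N + sum_list l \<le> ?B"
    using sum_list_le_length_encode [of N l] w by simp
  have f: "?f w = row_value C N l"
    unfolding w zero_extension_encode_if by (auto simp: row_value_def)
  have "computes (row_prog C) ?B ReadN (blocks l) (number_state C N) (row_value C N l)"
  proof (cases l)
    case Nil
    have state: "number_state 0 N = row_state 0 N []"
      by (auto simp: number_state_def row_state_def fun_eq_iff)
    have "computes (row_prog C) ?B (if C = 0 then Enough else Fail) [] (number_state C N)
        (row_value C N l)"
    proof (cases "C = 0")
      case True
      then show ?thesis
        using computes_row_Enough [of "[]" 0 ?B "[]" N] Nil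
        by (simp add: row_value_def is_partition_def state)
    qed (use Nil computes_Fail [of "row_prog C" C] in \<open>auto simp: row_value_def\<close>)
    then show ?thesis
      using Nil by - (simp, rule computes_Read_end, auto)
  next
    case (Cons p l')
    have "computes (row_prog C) ?B (if C = 0 then Fail else Row 1 0) (replicate p True @ blocks l')
        (number_state C N) (row_value C N l)"
    proof (cases "C = 0")
      case False
      have "number_state C N = row_state C N [0]"
        using False by (auto simp: number_state_def row_state_def row_length_def fun_eq_iff)
      then show ?thesis
        using False computes_row_parse [of "[]" 0 C p l' ?B N] bound Cons by simp
    qed (use Cons computes_Fail [of "row_prog C" C] in \<open>auto simp: row_value_def\<close>)
    then show ?thesis
      using Cons by - (simp, rule computes_Read, auto)
  qed
  then have "computes (row_prog C) ?B ReadN w (number_state C 0) (row_value C N l)"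
    unfolding w encode_blocks using bound [unfolded w encode_blocks] by (intro computes_ReadN) auto
  then show "computes (row_prog C) ?B ReadN w (\<lambda>_. 0) (?f w)"
    unfolding f by (simp add: number_state_def fun_upd_idem)
qed

subsection \<open>Rows of bounded length\<close>

text \<open>The counter values when the rows \<open>l\<close> have been completed and \<open>s\<close> cells have been read.\<close>

definition col_state :: "nat \<Rightarrow> nat \<Rightarrow> nat list \<Rightarrow> nat \<Rightarrow> nat \<Rightarrow> nat" where
  "col_state C N l s m = (if 1 \<le> m \<and> m \<le> C then count_list l m
     else if m = Suc C then N else if m = Suc (Suc C) then N - s else 0)"

lemma sum_count_list:
  "\<forall>p \<in> set l. p \<le> C \<Longrightarrow> (\<Sum>m = j..C. count_list l m) = length (filter (\<lambda>p. j \<le> p) l)" for C :: nat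
proof (induction l)
  case (Cons p l)
  have "(\<Sum>m = j..C. count_list (p # l) m) = (\<Sum>m = j..C. (if p = m then 1 else 0) + count_list l m)"
    by (intro sum.cong) auto
  also have "\<dots> = (\<Sum>m = j..C. if p = m then 1 else 0) + length (filter (\<lambda>p. j \<le> p) l)"
    using Cons by (simp add: sum.distrib)
  also have "(\<Sum>m = j..C. if p = m then 1 else 0) = (if j \<le> p then 1 else (0::nat))"
    using Cons.prems by simp
  finally show ?case by simp
qed simp

lemma tail_sum_col_state:
  assumes "\<forall>p \<in> set l. p \<le> C" and "1 \<le> j"
  shows "tail_sum C (col_state C N l s) j = length (filter (\<lambda>p. j \<le> p) l)"
proof -
  have "tail_sum C (col_state C N l s) j = (\<Sum>m = j..C. count_list l m)"
    unfolding tail_sum_def using assms(2) by (intro sum.cong) (auto simp: col_state_def)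
  then show ?thesis
    using sum_count_list [OF assms(1)] by simp
qed

text \<open>In a weakly decreasing list the entries that are at least \<open>j\<close> come first.\<close>

lemma less_length_filter_iff:
  "sorted_wrt (\<ge>) l \<Longrightarrow> i < length (filter (\<lambda>p. j \<le> p) l) \<longleftrightarrow> i < length l \<and> j \<le> l ! i" for j :: nat
proof (induction l arbitrary: i)
  case (Cons p l)
  show ?case
  proof (cases "j \<le> p")
    case True
    then show ?thesis
      using Cons by (cases i) auto
  next
    case False
    then have "filter (\<lambda>p. j \<le> p) l = []"
      using Cons.prems by (auto simp: filter_empty_conv)
    moreover have "\<not> j \<le> (p # l) ! i" if "i < length (p # l)"
      using nth_mem [OF that] Cons.prems False by (force simp del: nth_mem)
    ultimately show ?thesis
      using False by auto
  qed
qed simp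

lemma cols_shape_col_state:
  assumes "sorted_wrt (\<ge>) l" and le: "\<forall>p \<in> set l. p \<le> C"
  shows "cols_shape C (col_state C N l s) = young_diagram l"
proof -
  have "(i, j) \<in> cols_shape C (col_state C N l s) \<longleftrightarrow> (i, j) \<in> young_diagram l" for i j
  proof (cases "1 \<le> i \<and> 1 \<le> j")
    case True
    then have "i \<le> tail_sum C (col_state C N l s) j \<longleftrightarrow> i \<le> length l \<and> j \<le> l ! (i - 1)"
      using less_length_filter_iff [OF assms(1), of "i - 1" j] by (auto simp: tail_sum_col_state [OF le])
    moreover have "j \<le> C" if "i \<le> length l" "j \<le> l ! (i - 1)"
      using that True le nth_mem [of "i - 1" l] by (force simp del: nth_mem)
    ultimately show ?thesis
      using True by (auto simp: cols_shape_def young_diagram_def)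
  qed (auto simp: cols_shape_def young_diagram_def)
  then show ?thesis
    by auto
qed

lemma length_le_sum_list: "0 \<notin> set l \<Longrightarrow> length l \<le> sum_list l" for l :: "nat list"
  by (induction l) auto

lemma computes_col_Enough:
  assumes "is_partition l" and "\<forall>p \<in> set l. p \<le> C" and "sum_list l \<le> B"
  shows "computes (col_prog C) B Enough w (col_state C N l (sum_list l))
    (if N \<le> sum_list l then card (SSYT N l) else 0)"
proof -
  let ?v = "col_state C N l (sum_list l)"
  have "tail_sum C ?v 0 = tail_sum C ?v 1"
    by (simp add: tail_sum_Suc col_state_def)
  also have "\<dots> \<le> length l"
    by (simp add: tail_sum_col_state [OF assms(2)])
  also have "\<dots> \<le> sum_list l"
    using assms(1) by (simp add: is_partition_def length_le_sum_list)
  finally have "tail_sum C ?v 0 \<le> B"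
    using assms(3) by simp
  moreover have "?v (Suc C) = N" "?v (Suc (Suc C)) = N - sum_list l"
    by (simp_all add: col_state_def)
  moreover have "cols_shape C ?v = young_diagram l"
    using assms by (simp add: cols_shape_col_state is_partition_def)
  ultimately show ?thesis
    using computes_Enough [of "col_prog C" C, OF _ computes_col_rounds, of ?v B w]
    by (cases "N \<le> sum_list l") (simp_all add: SSYT_tableaux)
qed

lemma computes_col_ones:
  assumes "r \<le> b"
    and "r + a \<le> b \<Longrightarrow> computes (col_prog C) B (Row (r + a) b) w (col_state C N rs (s + a)) k"
    and "b < r + a \<Longrightarrow> k = 0"
  shows "computes (col_prog C) B (Row r b) (replicate a True @ w) (col_state C N rs s) k"
  using assms
proof (induction a arbitrary: r s)
  case (Suc a)
  have "computes (col_prog C) B (if r < b then Missing (Suc r) b else Fail) (replicate a True @ w)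
      (col_state C N rs s) k"
  proof (cases "r < b")
    case True
    have "computes (col_prog C) B (Row (Suc r) b) (replicate a True @ w) (col_state C N rs (Suc s)) k"
      using True Suc.prems by (intro Suc.IH) auto
    moreover have "col_state C N rs (Suc s) =
        (col_state C N rs s)(Suc (Suc C) := col_state C N rs s (Suc (Suc C)) - 1)"
      by (auto simp: col_state_def fun_eq_iff)
    ultimately show ?thesis
      using True by (auto intro: computes_Missing)
  next
    case False
    then show ?thesis
      using Suc.prems computes_Fail [of "col_prog C" C] by auto
  qed
  then show ?case
    by - (simp, rule computes_Read, auto)
qed simp

text \<open>The expected number of accepting paths on the encoding of \<open>(N, l)\<close>.\<close>

definition col_value :: "nat \<Rightarrow> nat \<Rightarrow> nat list \<Rightarrow> nat" where
  "col_value C N l =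
     (if is_partition l \<and> (l \<noteq> [] \<longrightarrow> hd l \<le> C) \<and> N \<le> sum_list l then card (SSYT N l) else 0)"

lemma is_partition_snoc:
  "is_partition rs \<Longrightarrow> is_partition (rs @ [a]) \<longleftrightarrow> 0 < a \<and> (rs \<noteq> [] \<longrightarrow> a \<le> last rs)"
  by (cases rs rule: rev_cases) (auto simp: is_partition_def sorted_wrt_append intro: order.trans)

text \<open>If a row exceeds its bound, the list of rows is a partition only if the row is the first one, and
  then it is longer than \<open>C\<close>.\<close>

lemma hd_greater_if_too_long:
  assumes "b = (if rs = [] then C else last rs)" and "b < a" and "is_partition (rs @ a # l)"
  shows "C < hd (rs @ a # l)"
proof (cases rs rule: rev_cases)
  case (snoc rs' q)
  then have "a \<le> q"
    using assms(3) by (simp add: is_partition_def sorted_wrt_append)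
  then show ?thesis
    using assms(1,2) snoc by simp
qed (use assms in simp)

text \<open>Storing a completed row of length \<open>a\<close>.\<close>

lemma computes_col_store:
  assumes "is_partition rs" and "a \<noteq> 0" and "a \<le> C" and "col_prog C q = Inc a q'"
    and "sum_list rs + a \<le> B"
    and "computes (col_prog C) B q' w (col_state C N (rs @ [a]) s) k"
  shows "computes (col_prog C) B q w (col_state C N rs s) k"
proof (rule computes_Inc [where i = a and r = q'])
  show "col_prog C q = Inc a q'"
    by fact
  have "count_list rs a \<le> sum_list rs"
    using count_le_length [of rs a] length_le_sum_list [of rs] assms(1)
    by (simp add: is_partition_def)
  then show "col_state C N rs s a < B"
    using assms(2,3,5) by (auto simp: col_state_def)
  have "(col_state C N rs s)(a := Suc (col_state C N rs s a)) = col_state C N (rs @ [a]) s"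
    using assms(2,3) by (auto simp: col_state_def fun_eq_iff)
  then show "computes (col_prog C) B q' w ((col_state C N rs s)(a := Suc (col_state C N rs s a))) k"
    using assms(6) by simp
qed

lemma computes_col_parse:
  assumes "is_partition rs" and "\<forall>p \<in> set rs. p \<le> C" and "b = (if rs = [] then C else last rs)"
    and "sum_list (rs @ a # l) \<le> B"
  shows "computes (col_prog C) B (Row 0 b) (replicate a True @ blocks l)
    (col_state C N rs (sum_list rs)) (col_value C N (rs @ a # l))"
  using assms
proof (induction l arbitrary: rs b a)
  case Nil
  let ?k = "col_value C N (rs @ [a])"
  have "computes (col_prog C) B (Row 0 b) (replicate a True @ blocks [])
      (col_state C N rs (sum_list rs)) ?k"
  proof (rule computes_col_ones)
    assume "0 + a \<le> b"
    then have last: "rs \<noteq> [] \<longrightarrow> a \<le> last rs" and "a \<le> C"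
      using Nil.prems(2,3) by (auto split: if_splits dest: bspec [OF _ last_in_set])
    let ?v = "col_state C N rs (sum_list rs + a)"
    have "computes (col_prog C) B (if a = 0 then Fail else LastRowEnd a) [] ?v ?k"
    proof (cases "a = 0")
      case False
      then have part: "is_partition (rs @ [a])"
        using last Nil.prems(1) by (simp add: is_partition_snoc)
      moreover have "\<forall>p \<in> set (rs @ [a]). p \<le> C"
        using Nil.prems(2) \<open>a \<le> C\<close> by auto
      ultimately have "computes (col_prog C) B Enough []
          (col_state C N (rs @ [a]) (sum_list rs + a)) ?k"
        using computes_col_Enough [of "rs @ [a]" C B "[]" N] Nil.prems(4)
        by (cases rs) (auto simp: col_value_def add.assoc)
      then show ?thesis
        using computes_col_store [OF Nil.prems(1) False \<open>a \<le> C\<close>, of "LastRowEnd a" Enough] False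
          Nil.prems(4) by simp
    qed (use computes_Fail [of "col_prog C" C] Nil in
        \<open>auto simp: col_value_def is_partition_def\<close>)
    then show "computes (col_prog C) B (Row (0 + a) b) (blocks []) ?v ?k"
      by - (simp, rule computes_Read_end, auto)
  qed (use Nil.prems hd_greater_if_too_long [of b rs C a "[]"] in \<open>auto simp: col_value_def\<close>)
  then show ?case .
next
  case (Cons p l)
  let ?k = "col_value C N (rs @ a # p # l)"
  show ?case
  proof (rule computes_col_ones)
    assume "0 + a \<le> b"
    then have last: "rs \<noteq> [] \<longrightarrow> a \<le> last rs" and "a \<le> C"
      using Cons.prems(2,3) by (auto split: if_splits dest: bspec [OF _ last_in_set])
    let ?v = "col_state C N rs (sum_list rs + a)"
    have "computes (col_prog C) B (if a = 0 then Fail else RowEnd a) (replicate p True @ blocks l) ?v ?k"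
    proof (cases "a = 0")
      case False
      then have part: "is_partition (rs @ [a])"
        using last Cons.prems(1) by (simp add: is_partition_snoc)
      then have "computes (col_prog C) B (Row 0 a) (replicate p True @ blocks l)
          (col_state C N (rs @ [a]) (sum_list rs + a)) ?k"
        using Cons.IH [of "rs @ [a]" a p] Cons.prems(2,4) \<open>a \<le> C\<close> by auto
      then show ?thesis
        using computes_col_store [OF Cons.prems(1) False \<open>a \<le> C\<close>, of "RowEnd a" "Row 0 a"] False
          Cons.prems(4) by simp
    qed (use computes_Fail [of "col_prog C" C] Cons in
        \<open>auto simp: col_value_def is_partition_def\<close>)
    then show "computes (col_prog C) B (Row (0 + a) b) (blocks (p # l)) ?v ?k"
      by - (simp, rule computes_Read, auto)
  qed (use Cons.prems hd_greater_if_too_long [of b rs C a "p # l"] in \<open>auto simp: col_value_def\<close>)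
qed

theorem col_count_in_sharp_L:
  "zero_extension encode {(N, l). is_partition l \<and> (l \<noteq> [] \<longrightarrow> hd l \<le> C) \<and> N \<le> sum_list l}
     (\<lambda>(N, l). card (SSYT N l)) \<in> sharp_L"
    (is "?f \<in> sharp_L")
proof (rule counter_machine.sharp_L_if_computes [OF counter_machine_col_prog])
  fix w
  obtain N l where w: "w = encode (N, l)"
    using ex_encode by blast
  let ?B = "Suc (length w)"
  have bound: "N + sum_list l \<le> ?B"
    using sum_list_le_length_encode [of N l] w by simp
  have f: "?f w = col_value C N l"
    unfolding w zero_extension_encode_if by (auto simp: col_value_def)
  have state: "number_state C N = col_state C N [] 0"
    by (auto simp: number_state_def col_state_def fun_eq_iff)
  have "computes (col_prog C) ?B ReadN (blocks l) (number_state C N) (col_value C N l)"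
  proof (cases l)
    case Nil
    then show ?thesis
      using computes_col_Enough [of "[]" C ?B "[]" N]
      by - (simp, rule computes_Read_end, auto simp: state col_value_def is_partition_def)
  next
    case (Cons p l')
    then have "computes (col_prog C) ?B (Row 0 C) (replicate p True @ blocks l')
        (number_state C N) (col_value C N l)"
      using computes_col_parse [of "[]" C C p l' ?B N] bound by (simp add: state is_partition_def)
    then show ?thesis
      using Cons by - (simp, rule computes_Read, auto)
  qed
  then have "computes (col_prog C) ?B ReadN w (number_state C 0) (col_value C N l)"
    unfolding w encode_blocks using bound [unfolded w encode_blocks] by (intro computes_ReadN) auto
  then show "computes (col_prog C) ?B ReadN w (\<lambda>_. 0) (?f w)"
    unfolding f by (simp add: number_state_def fun_upd_idem)
qed

theorem corollary3p17:
  fixes C :: nat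
  shows "zero_extension encode
           {(N, l). is_partition l \<and> length l = C \<and> N \<le> sum_list l}
           (\<lambda>(N, l). card (SSYT N l)) \<in> sharp_L \<and>
         zero_extension encode
           {(N, l). is_partition l \<and> (l \<noteq> [] \<longrightarrow> hd l \<le> C) \<and> N \<le> sum_list l}
           (\<lambda>(N, l). card (SSYT N l)) \<in> sharp_L"
  using row_count_in_sharp_L col_count_in_sharp_L by blast

end
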